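(* Let $(Y_i,Z_i)_{0\le i\le n}$ be the solution of the scheme $\mathcal E[(F_i),\xi]$ (see context). Assume: (a) $\xi\in L^\infty(\mathcal F_T)$; (b) each $F_i:\Omega\times\mathbb R\times\mathbb R^{1\times d}\to\mathbb R$, $0\le i\le n-1$, is $\mathcal F_{t_i}\otimes\mathcal B(\mathbb R)\otimes\mathcal B(\mathbb R^{1\times d})$-measurable, with $F_i(0,0)\in L^2(\mathcal F_{t_i})$ and $|F_i(y,z)-F_i(y',z')|\le K_y|y-y'|+K^n_z|z-z'|$, where the positive constants $K_y,K_z^n$ do not depend on $i$ ($K_y$ does not depend on $n$, $K^n_z$ may depend on $n$); $hK_y<1-\varepsilon$ for a given $\varepsilon\in(0,1)$ not depending on $n$; and $(\sup_{0\le i\le n-1}h_i|H_i|)K^n_z<1$; (c) $F_i(0,0)\in L^\infty(\mathcal F_{t_i})$ for $0\le i\le n-1$ and $\sup_{0\le i\le n-1}|F_i(0,0)|\le\tilde C$ for a constant $\tilde C$ not depending on $n$; (d) there are positive constants $\tilde L,\tilde\Lambda$ not depending on $n$ and random variables $\varsigma_i$ such that $|F_i(y,z)|\le K_y|y|+\tilde L|z|^2+\varsigma_i$ for all $y,z$, and $\mathbb E_{t_i}\big[\sum_{k=i}^{n-1}h_k|\varsigma_k|\big]\le\tilde\Lambda$, for all $0\le i\le n-1$. Then there is a constant $C$ not depending on $n$ such that $$\mathbb E_{t_i}\Big[\sum_{k=i}^{n-1}h_k|Z_k|^2\Big]\le C,\qquad 0\le i\le n-1.$$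
   Context: $(\mathcal F_t)_{0\le t\le T}$ is the Brownian filtration on $(\Omega,\mathcal A,\mathbb P)$ of a $d$-dimensional Brownian motion, $\mathbb E_t[\cdot]=\mathbb E[\cdot|\mathcal F_t]$. For each $n$ the grid is $0=t_0<\dots<t_n=T$, $h_i=t_{i+1}-t_i$, $h=\max_ih_i$, with $hn\le c_1$ and $h_in^\theta\ge c_2$ for constants $c_1,c_2>0$, $\theta\ge1$ independent of $n$. The coefficients $(H_i)_{0\le i<n}$ are independent $\mathbb R^{1\times d}$-valued random vectors such that $H_i$ is $\mathcal F_{t_{i+1}}$-measurable, $\mathbb E_{t_i}[H_i]=0$, and $c_iI_{d\times d}=h_i\mathbb E[H_i^\top H_i]=h_i\mathbb E_{t_i}[H_i^\top H_i]$ with $\lambda/d\le c_i\le\Lambda/d$ for positive constants $\lambda,\Lambda$ independent of $n$. The scheme $\mathcal E[(F_i),\xi]$ has solution $(Y_i,Z_i)_{0\le i\le n}$ (adapted to $(\mathcal F_{t_i})$) defined by $Y_n=\xi$, $Z_n=0$ and for $0\le i<n$ $$Y_i=\mathbb E_{t_i}[Y_{i+1}+h_iF_i(Y_i,Z_i)],\qquad Z_i=\mathbb E_{t_i}[Y_{i+1}H_i].$$ If $\xi$ depends on $n$, its $L^\infty$ norm is understood to be bounded independently of $n$. *)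

theory Defs
  imports "HOL-Probability.Probability"
begin

text \<open>Standard \<open>d\<close>-dimensional Brownian motion on the time interval \<open>[0, T]\<close>, \<open>d = CARD('d)\<close>.\<close>

definition brownian_motion :: "'a measure \<Rightarrow> real \<Rightarrow> (real \<Rightarrow> 'a \<Rightarrow> real ^ 'd::finite) \<Rightarrow> bool" where
  "brownian_motion M T W \<longleftrightarrow>
     prob_space M \<and>
     (\<forall>t\<in>{0..T}. W t \<in> borel_measurable M) \<and>
     (AE \<omega> in M. W 0 \<omega> = 0) \<and>
     (\<forall>s t. 0 \<le> s \<and> s < t \<and> t \<le> T \<longrightarrow>
        prob_space.indep_vars M (\<lambda>_. borel) (\<lambda>j \<omega>. (W t \<omega> - W s \<omega>) $ j) UNIV \<and>
        (\<forall>j. distributed M lborel (\<lambda>\<omega>. (W t \<omega> - W s \<omega>) $ j) (normal_density 0 (sqrt (t - s))))) \<and>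
     (\<forall>(m::nat) s. 0 \<le> s 0 \<and> (\<forall>i<m. s i < s (Suc i)) \<and> s m \<le> T \<longrightarrow>
        prob_space.indep_vars M (\<lambda>_. borel) (\<lambda>i \<omega>. W (s (Suc i)) \<omega> - W (s i) \<omega>) {..<m}) \<and>
     (AE \<omega> in M. continuous_on {0..T} (\<lambda>t. W t \<omega>))"

text \<open>The natural filtration of \<open>W\<close>, augmented by the null sets of \<open>M\<close>.\<close>

definition brownian_filtration ::
    "'a measure \<Rightarrow> (real \<Rightarrow> 'a \<Rightarrow> real ^ 'd::finite) \<Rightarrow> real \<Rightarrow> 'a measure" where
  "brownian_filtration M W t =
     sigma (space M) ({W s -` A \<inter> space M | s A. s \<in> {0..t} \<and> A \<in> sets borel} \<union> null_sets M)"

text \<open>Conditional expectations of vectors and matrices are taken entrywise. They are meaningful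
  only for integrable arguments, so integrability is required wherever they are used.\<close>

definition vec_cond_exp ::
    "'a measure \<Rightarrow> 'a measure \<Rightarrow> ('a \<Rightarrow> real ^ 'd::finite) \<Rightarrow> 'a \<Rightarrow> real ^ 'd" where
  "vec_cond_exp M G X \<omega> = (\<chi> j. real_cond_exp M G (\<lambda>\<omega>'. X \<omega>' $ j) \<omega>)"

definition mat_cond_exp ::
    "'a measure \<Rightarrow> 'a measure \<Rightarrow> ('a \<Rightarrow> real ^ 'd::finite ^ 'd) \<Rightarrow> 'a \<Rightarrow> real ^ 'd ^ 'd" where
  "mat_cond_exp M G X \<omega> = (\<chi> i j. real_cond_exp M G (\<lambda>\<omega>'. X \<omega>' $ i $ j) \<omega>)"

text \<open>Row vectors with \<open>d\<close> real entries are modelled by \<open>real ^ 'd\<close>; this is the \<open>d \<times> d\<close>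
  matrix \<open>(transpose v) v\<close>.\<close>

definition outer :: "real ^ 'd::finite \<Rightarrow> real ^ 'd ^ 'd" where
  "outer v = (\<chi> i j. v $ i * v $ j)"

text \<open>A grid is given by \<open>t 0, \<dots>, t n\<close>; the values \<open>t i\<close> with \<open>i > n\<close> play no role.\<close>

definition step :: "(nat \<Rightarrow> real) \<Rightarrow> nat \<Rightarrow> real" where
  "step t i = t (Suc i) - t i"

definition mesh :: "nat \<Rightarrow> (nat \<Rightarrow> real) \<Rightarrow> real" where
  "mesh n t = (MAX i\<in>{..<n}. step t i)"

definition time_grid ::
    "real \<Rightarrow> real \<Rightarrow> real \<Rightarrow> real \<Rightarrow> nat \<Rightarrow> (nat \<Rightarrow> real) \<Rightarrow> bool" where
  "time_grid T c1 c2 \<theta> n t \<longleftrightarrow>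
     t 0 = 0 \<and> t n = T \<and> (\<forall>i<n. t i < t (Suc i)) \<and>
     mesh n t * real n \<le> c1 \<and> (\<forall>i<n. step t i * real n powr \<theta> \<ge> c2)"

text \<open>The standing assumptions on the coefficients \<open>H i\<close>, \<open>i < n\<close>; \<open>G\<close> is the filtration,
  indexed by (real) time.\<close>

definition scheme_coefficients ::
    "'a measure \<Rightarrow> (real \<Rightarrow> 'a measure) \<Rightarrow> real \<Rightarrow> real \<Rightarrow> nat \<Rightarrow> (nat \<Rightarrow> real) \<Rightarrow>
     (nat \<Rightarrow> real) \<Rightarrow> (nat \<Rightarrow> 'a \<Rightarrow> real ^ 'd::finite) \<Rightarrow> bool" where
  "scheme_coefficients M G lam Lam n t c H \<longleftrightarrow>
     prob_space.indep_vars M (\<lambda>_. borel) H {..<n} \<and>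
     (\<forall>i<n.
        H i \<in> borel_measurable (G (t (Suc i))) \<and>
        integrable M (\<lambda>\<omega>. (norm (H i \<omega>))\<^sup>2) \<and>
        (AE \<omega> in M. vec_cond_exp M (G (t i)) (H i) \<omega> = 0) \<and>
        mat (c i) = step t i *\<^sub>R integral\<^sup>L M (\<lambda>\<omega>. outer (H i \<omega>)) \<and>
        (AE \<omega> in M. mat (c i) = step t i *\<^sub>R mat_cond_exp M (G (t i)) (\<lambda>\<omega>'. outer (H i \<omega>')) \<omega>) \<and>
        lam / real CARD('d) \<le> c i \<and> c i \<le> Lam / real CARD('d))"

text \<open>\<open>(Y, Z)\<close> solves the scheme with driver \<open>F\<close> and terminal value \<open>\<xi>\<close>. As usual, equalities between
  random variables hold almost surely; no integrability is imposed beyond what is needed for the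
  conditional expectations to exist.\<close>

definition scheme_solution ::
    "'a measure \<Rightarrow> (real \<Rightarrow> 'a measure) \<Rightarrow> nat \<Rightarrow> (nat \<Rightarrow> real) \<Rightarrow>
     (nat \<Rightarrow> 'a \<Rightarrow> real ^ 'd::finite) \<Rightarrow> (nat \<Rightarrow> 'a \<Rightarrow> real \<Rightarrow> real ^ 'd \<Rightarrow> real) \<Rightarrow> ('a \<Rightarrow> real) \<Rightarrow>
     (nat \<Rightarrow> 'a \<Rightarrow> real) \<Rightarrow> (nat \<Rightarrow> 'a \<Rightarrow> real ^ 'd) \<Rightarrow> bool" where
  "scheme_solution M G n t H F \<xi> Y Z \<longleftrightarrow>
     (\<forall>i\<le>n. Y i \<in> borel_measurable (G (t i)) \<and> Z i \<in> borel_measurable (G (t i))) \<and>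
     (AE \<omega> in M. Y n \<omega> = \<xi> \<omega>) \<and> (AE \<omega> in M. Z n \<omega> = 0) \<and>
     (\<forall>i<n.
        integrable M (\<lambda>\<omega>. Y (Suc i) \<omega> + step t i * F i \<omega> (Y i \<omega>) (Z i \<omega>)) \<and>
        integrable M (\<lambda>\<omega>. Y (Suc i) \<omega> *\<^sub>R H i \<omega>) \<and>
        (AE \<omega> in M. Y i \<omega> =
           real_cond_exp M (G (t i)) (\<lambda>\<omega>'. Y (Suc i) \<omega>' + step t i * F i \<omega>' (Y i \<omega>') (Z i \<omega>')) \<omega>) \<and>
        (AE \<omega> in M. Z i \<omega> = vec_cond_exp M (G (t i)) (\<lambda>\<omega>'. Y (Suc i) \<omega>' *\<^sub>R H i \<omega>') \<omega>))"

end

theory Submission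
  imports Defs
begin

text \<open>The variables \<open>Y\<^sub>i\<close> are bounded by a constant \<open>B\<close> uniformly in \<open>n\<close>: since \<open>h\<^sub>i K\<^sub>z |H\<^sub>i| \<le> 1\<close>, the
  Lipschitz contribution of \<open>Z\<^sub>i\<close> is absorbed by a change of measure with density
  \<open>1 \<plusminus> h\<^sub>i K\<^sub>z e \<bullet> H\<^sub>i \<ge> 0\<close>.

  The bound on \<open>Z\<close> comes from the drift of \<open>exp (\<alpha> Y\<^sub>i)\<close> with \<open>\<alpha> = 8 L \<Lambda> / d\<close>. A Taylor expansion is not
  enough, because the increments of \<open>Y\<close> need not be small. Instead, quadratic growth and Lipschitz
  continuity together give, up to the terms in \<open>K\<^sub>y\<close> and \<open>\<varsigma>\<^sub>i\<close>,
  \<open>h\<^sub>i F\<^sub>i \<le> R := h\<^sub>i (\<gamma> |Z\<^sub>i| - \<gamma>\<^sup>2 / (4 L))\<close> with \<open>\<gamma> = min K\<^sub>z (2 L |Z\<^sub>i|)\<close>. For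
  \<open>g = h\<^sub>i \<gamma> e \<bullet> H\<^sub>i\<close> with \<open>e = Z\<^sub>i / |Z\<^sub>i|\<close> one has \<open>|g| \<le> 1\<close>, \<open>E\<^sub>i g = 0\<close>,
  \<open>E\<^sub>i [Y\<^sub>i\<^sub>+\<^sub>1 g] = h\<^sub>i \<gamma> |Z\<^sub>i|\<close> and \<open>E\<^sub>i g\<^sup>2 = h\<^sub>i c\<^sub>i \<gamma>\<^sup>2\<close>. Insert
  \<open>v = \<alpha> (Y\<^sub>i\<^sub>+\<^sub>1 - E\<^sub>i Y\<^sub>i\<^sub>+\<^sub>1 - R)\<close> into the pointwise inequality
  \<open>exp v \<ge> 1 + (1 + g) v - 2 g\<^sup>2 + k v\<^sup>2\<close> (\<open>|g| \<le> 1\<close>, \<open>v\<close> bounded): the terms in \<open>g\<close> pay for \<open>R\<close>, and the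
  remaining \<open>k v\<^sup>2\<close> dominates \<open>h\<^sub>i |Z\<^sub>i|\<^sup>2\<close> by Cauchy-Schwarz. Summing over the steps gives the claim.\<close>

section \<open>Lower bounds for the exponential\<close>

text \<open>Fenchel-Young duality between \<open>exp\<close> and \<open>a ln a\<close> at \<open>a = 1 + g\<close>, with \<open>ln (1 + g) \<le> g\<close>.\<close>

lemma exp_ge_entropy:
  fixes g v :: real
  assumes "-1 \<le> g"
  shows "1 - g\<^sup>2 + (1 + g) * v \<le> exp v"
proof (cases "g = -1")
  case False
  define a where "a = 1 + g"
  have a: "a > 0" using False assms by (simp add: a_def)
  have "a * (1 + v - g) \<le> a * (1 + (v - ln a))"
    using a ln_le_minus_one[OF a] by (intro mult_left_mono) (auto simp: a_def)
  also have "\<dots> \<le> a * exp (v - ln a)"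
    using a by (intro mult_left_mono exp_ge_add_one_self) auto
  also have "\<dots> = exp v"
    using a by (simp add: exp_diff)
  finally show ?thesis
    by (simp add: a_def algebra_simps power2_eq_square)
qed simp

text \<open>Second-order Maclaurin expansion: the intermediate point in the remainder is at least
  \<open>- V\<close>.\<close>

lemma exp_ge_quadratic:
  fixes v V :: real
  assumes "\<bar>v\<bar> \<le> V"
  shows "1 + v + exp (- V) / 2 * v\<^sup>2 \<le> exp v"
proof -
  obtain s where s: "\<bar>s\<bar> \<le> \<bar>v\<bar>" "exp v = (\<Sum>k<2. v ^ k / fact k) + exp s / fact 2 * v ^ 2"
    using Maclaurin_exp_le[of v 2] by blast
  have "exp (- V) \<le> exp s" using s(1) assms by simp
  then have "exp (- V) / 2 * v\<^sup>2 \<le> exp s / 2 * v\<^sup>2"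
    by (intro mult_right_mono) auto
  then show ?thesis using s(2) by (simp add: numeral_2_eq_2)
qed

text \<open>Two cases, with \<open>q = exp (- V) / 4\<close>. If \<open>q |v|\<close> is at most
  \<open>|g|\<close>, one of the two \<open>g^2\<close> pays for \<open>(q v)^2\<close> and the
  entropy bound does the rest. Otherwise \<open>|g v|\<close> is at most \<open>q v^2\<close>, and
  the quadratic bound, which offers \<open>2 q v^2\<close>, covers both \<open>g v\<close> and
  \<open>(q v)^2\<close>.\<close>

lemma exp_ge_entropy_quadratic:
  fixes g v V :: real
  assumes "\<bar>v\<bar> \<le> V" "\<bar>g\<bar> \<le> 1"
  shows "1 + (1 + g) * v - 2 * g\<^sup>2 + (exp (- V))\<^sup>2 / 16 * v\<^sup>2 \<le> exp v"
proof -
  define q where "q = exp (- V) / 4"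
  have q: "0 < q" "q \<le> 1 / 4" using assms by (auto simp: q_def)
  have q2: "(exp (- V))\<^sup>2 / 16 * v\<^sup>2 = (q * v)\<^sup>2"
    by (simp add: q_def power2_eq_square)
  show ?thesis
  proof (cases "\<bar>q * v\<bar> \<le> \<bar>g\<bar>")
    case True
    then have "(q * v)\<^sup>2 \<le> g\<^sup>2" by (simp add: abs_le_square_iff)
    with exp_ge_entropy[of g v] assms(2) show ?thesis unfolding q2 by (auto simp: abs_le_iff)
  next
    case False
    then have "\<bar>g * v\<bar> \<le> q * v\<^sup>2"
      using mult_right_mono[of "\<bar>g\<bar>" "\<bar>q * v\<bar>" "\<bar>v\<bar>"] q
      by (simp add: abs_mult power2_eq_square)
    moreover have "(q * v)\<^sup>2 \<le> q * v\<^sup>2"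
      using mult_right_mono[of "q * q" q "v\<^sup>2"] q mult_left_mono[of q 1 q]
      by (simp add: power2_eq_square mult_ac)
    moreover have "1 + v + 2 * (q * v\<^sup>2) \<le> exp v"
      using exp_ge_quadratic[OF assms(1)] by (simp add: q_def)
    moreover have "0 \<le> g\<^sup>2" "(1 + g) * v = v + g * v"
      by (simp_all add: algebra_simps)
    ultimately show ?thesis unfolding q2 by linarith
  qed
qed

section \<open>Essentially bounded random variables and conditional expectations\<close>

text \<open>Bundles measurability with an almost sure bound, so that integrability of long
  expressions in \<open>X\<close>, \<open>H\<close> and \<open>Z\<close> follows from closure rules
  alone.\<close>

definition ess_bounded :: "'a measure \<Rightarrow> ('a \<Rightarrow> 'b::real_normed_vector) \<Rightarrow> bool" where
  "ess_bounded M f \<longleftrightarrow> f \<in> borel_measurable M \<and> (\<exists>K. AE x in M. norm (f x) \<le> K)"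

lemma ess_boundedI:
  "f \<in> borel_measurable M \<Longrightarrow> AE x in M. norm (f x) \<le> K \<Longrightarrow> ess_bounded M f"
  unfolding ess_bounded_def by blast

lemma ess_bounded_measurable [measurable_dest]: "ess_bounded M f \<Longrightarrow> f \<in> borel_measurable M"
  by (simp add: ess_bounded_def)

lemma ess_bounded_const: "ess_bounded M (\<lambda>_. k)"
  by (auto simp: ess_bounded_def)

lemma ess_bounded_indicator: "A \<in> sets M \<Longrightarrow> ess_bounded M (indicator A :: _ \<Rightarrow> real)"
  by (auto intro!: ess_boundedI[where K = 1] simp: indicator_def)

lemma ess_bounded_norm: "ess_bounded M f \<Longrightarrow> ess_bounded M (\<lambda>x. norm (f x))"
  by (auto simp: ess_bounded_def)

lemma ess_bounded_add:
  fixes f g :: "'a \<Rightarrow> 'b::{real_normed_vector, second_countable_topology}"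
  assumes "ess_bounded M f" "ess_bounded M g"
  shows "ess_bounded M (\<lambda>x. f x + g x)"
proof -
  obtain K L where "AE x in M. norm (f x) \<le> K" "AE x in M. norm (g x) \<le> L"
    using assms by (auto simp: ess_bounded_def)
  then have "AE x in M. norm (f x + g x) \<le> K + L"
    by eventually_elim (rule norm_triangle_le, linarith)
  then show ?thesis using assms by (auto simp: ess_bounded_def)
qed

text \<open>A single argument for products, scalings and inner products.\<close>

lemma ess_bounded_bilinear:
  assumes "bounded_bilinear P" "ess_bounded M f" "ess_bounded M g"
    and "(\<lambda>x. P (f x) (g x)) \<in> borel_measurable M"
  shows "ess_bounded M (\<lambda>x. P (f x) (g x))"
proof -
  interpret bounded_bilinear P by fact
  obtain K where K: "\<And>a b. norm (P a b) \<le> norm a * norm b * K" "0 \<le> K"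
    using nonneg_bounded by blast
  obtain A B where "AE x in M. norm (f x) \<le> A" "AE x in M. norm (g x) \<le> B"
    using assms by (auto simp: ess_bounded_def)
  then have "AE x in M. norm (P (f x) (g x)) \<le> A * B * K"
  proof eventually_elim
    case (elim x)
    then have "norm (f x) * norm (g x) * K \<le> A * B * K"
      using K(2) order_trans[OF norm_ge_zero elim(1)]
      by (intro mult_right_mono mult_mono) auto
    with K(1)[of "f x" "g x"] show ?case by linarith
  qed
  then show ?thesis using assms(4) by (auto simp: ess_bounded_def)
qed

lemma ess_bounded_mult:
  fixes f g :: "'a \<Rightarrow> real"
  shows "ess_bounded M f \<Longrightarrow> ess_bounded M g \<Longrightarrow> ess_bounded M (\<lambda>x. f x * g x)"
  by (rule ess_bounded_bilinear[OF bounded_bilinear_mult]) (auto simp: ess_bounded_def)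

lemma ess_bounded_scaleR:
  fixes g :: "'a \<Rightarrow> 'b::{real_normed_vector, second_countable_topology}"
  shows "ess_bounded M f \<Longrightarrow> ess_bounded M g \<Longrightarrow> ess_bounded M (\<lambda>x. f x *\<^sub>R g x)"
  by (rule ess_bounded_bilinear[OF bounded_bilinear_scaleR]) (auto simp: ess_bounded_def)

lemma ess_bounded_inner:
  fixes f g :: "'a \<Rightarrow> 'b::{real_inner, second_countable_topology}"
  shows "ess_bounded M f \<Longrightarrow> ess_bounded M g \<Longrightarrow> ess_bounded M (\<lambda>x. f x \<bullet> g x)"
  by (rule ess_bounded_bilinear[OF bounded_bilinear_inner]) (auto simp: ess_bounded_def)

lemma ess_bounded_diff:
  fixes f g :: "'a \<Rightarrow> real"
  assumes "ess_bounded M f" "ess_bounded M g"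
  shows "ess_bounded M (\<lambda>x. f x - g x)"
  using ess_bounded_add[OF assms(1) ess_bounded_mult[OF ess_bounded_const[of M "-1"] assms(2)]] by simp

lemma ess_bounded_power2:
  fixes f :: "'a \<Rightarrow> real"
  shows "ess_bounded M f \<Longrightarrow> ess_bounded M (\<lambda>x. (f x)\<^sup>2)"
  by (simp add: power2_eq_square ess_bounded_mult)

lemma ess_bounded_nth:
  fixes f :: "'a \<Rightarrow> real ^ 'd::finite"
  assumes "ess_bounded M f"
  shows "ess_bounded M (\<lambda>x. f x $ j)"
  using ess_bounded_inner[OF assms ess_bounded_const[of M "axis j 1"]] by (simp add: inner_axis)

lemma ess_bounded_exp:
  fixes f :: "'a \<Rightarrow> real"
  assumes "ess_bounded M f"
  shows "ess_bounded M (\<lambda>x. exp (f x))"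
proof -
  obtain K where "AE x in M. norm (f x) \<le> K"
    using assms by (auto simp: ess_bounded_def)
  then have "AE x in M. norm (exp (f x)) \<le> exp K" by eventually_elim auto
  moreover have "(\<lambda>x. exp (f x)) \<in> borel_measurable M" using assms by measurable
  ultimately show ?thesis by (rule ess_boundedI[rotated])
qed

lemmas ess_bounded_intros = ess_bounded_const ess_bounded_norm ess_bounded_add ess_bounded_mult
  ess_bounded_scaleR ess_bounded_inner ess_bounded_diff ess_bounded_power2 ess_bounded_nth
  ess_bounded_exp

lemma (in finite_measure) integrable_ess_bounded:
  fixes f :: "'a \<Rightarrow> 'b::{banach, second_countable_topology}"
  shows "ess_bounded M f \<Longrightarrow> integrable M f"
  unfolding ess_bounded_def using integrable_const_bound by blast

section \<open>Conditional inequalities tested on sets of the sub-sigma-algebra\<close>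

context finite_measure_subalgebra
begin

text \<open>The set where \<open>f\<close> is negative is itself an admissible \<open>A\<close>, and
  the integral of \<open>f\<close> over it has to vanish. This reduces almost sure inequalities to
  inequalities between integrals.\<close>

lemma AE_nonneg_if_integrals_nonneg:
  fixes f :: "'a \<Rightarrow> real"
  assumes f: "f \<in> borel_measurable F" "integrable M f"
    and nonneg: "\<And>A. A \<in> sets F \<Longrightarrow> 0 \<le> (\<integral>x. indicator A x * f x \<partial>M)"
  shows "AE x in M. 0 \<le> f x"
proof -
  define A where "A = {x \<in> space F. f x < 0}"
  have A: "A \<in> sets F" unfolding A_def using f(1) by measurable
  have AM: "A \<in> sets M" using A subalg by (auto simp: subalgebra_def)
  have int: "integrable M (\<lambda>x. - (indicator A x * f x))"
    using integrable_mult_indicator[OF AM f(2)] by simp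
  have ge: "0 \<le> - (indicator A x * f x)" for x
    by (auto simp: A_def indicator_def)
  have "(\<integral>x. - (indicator A x * f x) \<partial>M) = 0"
  proof (rule antisym)
    show "(\<integral>x. - (indicator A x * f x) \<partial>M) \<le> 0" using nonneg[OF A] by simp
    show "0 \<le> (\<integral>x. - (indicator A x * f x) \<partial>M)" using ge by (intro integral_nonneg_AE) simp
  qed
  then have "AE x in M. - (indicator A x * f x) = 0"
    using integral_nonneg_eq_0_iff_AE[OF int] ge by simp
  with AE_space show ?thesis
  proof eventually_elim
    case (elim x)
    then show ?case
      using subalg by (auto simp: A_def subalgebra_def indicator_def not_le split: if_splits)
  qed
qed

text \<open>The test set is the one where the conditional expectation exceeds \<open>C\<close>. The
  integral of \<open>C\<close> over it is finite, so unless the set is null the two integrals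
  compare strictly, against the hypothesis.\<close>

lemma nn_cond_exp_le_constI:
  fixes f :: "'a \<Rightarrow> real"
  assumes f: "integrable M f" "\<And>x. 0 \<le> f x" and C: "0 \<le> C"
    and le: "\<And>A. A \<in> sets F \<Longrightarrow> (\<integral>x. indicator A x * f x \<partial>M) \<le> C * measure M A"
  shows "AE x in M. nn_cond_exp M F (\<lambda>x. ennreal (f x)) x \<le> ennreal C"
proof -
  let ?N = "nn_cond_exp M F (\<lambda>x. ennreal (f x))"
  define A where "A = {x \<in> space F. ennreal C < ?N x}"
  have A [measurable]: "A \<in> sets F" unfolding A_def by measurable
  have AM: "A \<in> sets M" using A subalg by (auto simp: subalgebra_def)
  have N_meas: "?N \<in> borel_measurable M" by (rule measurable_from_subalg[OF subalg]) simp
  have f_meas: "(\<lambda>x. ennreal (f x)) \<in> borel_measurable M" using f(1) by simp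
  have "(\<integral>\<^sup>+x. indicator A x * ?N x \<partial>M) = (\<integral>\<^sup>+x. indicator A x * ennreal (f x) \<partial>M)"
    using f_meas by (intro nn_cond_exp_intg) auto
  also have "\<dots> = (\<integral>\<^sup>+x. ennreal (indicator A x * f x) \<partial>M)"
    by (intro nn_integral_cong) (simp add: indicator_def)
  also have "\<dots> = ennreal (\<integral>x. indicator A x * f x \<partial>M)"
    using integrable_mult_indicator[OF AM f(1)] f(2)
    by (intro nn_integral_eq_integral) (auto simp: indicator_def)
  also have "\<dots> \<le> ennreal (C * measure M A)" using le[OF A] by (rule ennreal_leI)
  also have "\<dots> = (\<integral>\<^sup>+x. ennreal C * indicator A x \<partial>M)"
    using AM C by (simp add: nn_integral_cmult_indicator emeasure_eq_measure ennreal_mult)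
  finally have le': "(\<integral>\<^sup>+x. indicator A x * ?N x \<partial>M) \<le> (\<integral>\<^sup>+x. ennreal C * indicator A x \<partial>M)" .
  have "AE x in M. indicator A x * ?N x \<le> ennreal C * indicator A x"
  proof (rule ccontr)
    assume "\<not> (AE x in M. indicator A x * ?N x \<le> ennreal C * indicator A x)"
    moreover have "(\<integral>\<^sup>+x. ennreal C * indicator A x \<partial>M) \<noteq> \<infinity>"
      using AM C by (simp add: nn_integral_cmult_indicator emeasure_eq_measure flip: ennreal_mult)
    moreover have "AE x in M. ennreal C * indicator A x \<le> indicator A x * ?N x"
      by (auto simp: A_def indicator_def)
    ultimately have "(\<integral>\<^sup>+x. ennreal C * indicator A x \<partial>M) < (\<integral>\<^sup>+x. indicator A x * ?N x \<partial>M)"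
      using AM N_meas by (intro nn_integral_less) auto
    with le' show False by simp
  qed
  with AE_space show ?thesis
  proof eventually_elim
    case (elim x)
    show ?case
    proof (rule ccontr)
      assume "\<not> ?case"
      with elim show False using subalg by (auto simp: A_def subalgebra_def)
    qed
  qed
qed

text \<open>Converse of \<open>nn_cond_exp_le_constI\<close>. Integrability is part of the
  conclusion: testing on the whole space bounds the integral of \<open>f\<close>.\<close>

lemma nn_cond_exp_le_constD:
  fixes f :: "'a \<Rightarrow> real"
  assumes f: "f \<in> borel_measurable M" "\<And>x. 0 \<le> f x" and C: "0 \<le> C"
    and le: "AE x in M. nn_cond_exp M F (\<lambda>x. ennreal (f x)) x \<le> ennreal C"
  shows "integrable M f" "A \<in> sets F \<Longrightarrow> (\<integral>x. indicator A x * f x \<partial>M) \<le> C * measure M A"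
proof -
  let ?N = "nn_cond_exp M F (\<lambda>x. ennreal (f x))"
  have f_meas: "(\<lambda>x. ennreal (f x)) \<in> borel_measurable M" using f(1) by simp
  have *: "(\<integral>\<^sup>+x. ennreal (indicator A x * f x) \<partial>M) \<le> ennreal (C * measure M A)"
    if A [measurable]: "A \<in> sets F" for A
  proof -
    have AM: "A \<in> sets M" using A subalg by (auto simp: subalgebra_def)
    have "(\<integral>\<^sup>+x. ennreal (indicator A x * f x) \<partial>M) = (\<integral>\<^sup>+x. indicator A x * ennreal (f x) \<partial>M)"
      by (intro nn_integral_cong) (simp add: indicator_def)
    also have "\<dots> = (\<integral>\<^sup>+x. indicator A x * ?N x \<partial>M)"
      using f_meas by (intro nn_cond_exp_intg[symmetric]) auto
    also have "\<dots> \<le> (\<integral>\<^sup>+x. ennreal C * indicator A x \<partial>M)"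
      using le by (intro nn_integral_mono_AE) (auto elim!: eventually_mono simp: indicator_def)
    also have "\<dots> = ennreal (C * measure M A)"
      using AM C by (simp add: nn_integral_cmult_indicator emeasure_eq_measure ennreal_mult)
    finally show ?thesis .
  qed
  have "(\<integral>\<^sup>+x. ennreal (f x) \<partial>M) = (\<integral>\<^sup>+x. ennreal (indicator (space F) x * f x) \<partial>M)"
    using subalg by (intro nn_integral_cong) (auto simp: indicator_def subalgebra_def)
  also have "\<dots> < \<infinity>" using le_less_trans[OF *[OF sets.top]] by simp
  finally show int: "integrable M f" using f by (intro integrableI_nonneg) auto
  assume A: "A \<in> sets F"
  have AM: "A \<in> sets M" using A subalg by (auto simp: subalgebra_def)
  have "ennreal (\<integral>x. indicator A x * f x \<partial>M) = (\<integral>\<^sup>+x. ennreal (indicator A x * f x) \<partial>M)"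
    using integrable_mult_indicator[OF AM int] f(2)
    by (intro nn_integral_eq_integral[symmetric]) (auto simp: indicator_def)
  with *[OF A] show "(\<integral>x. indicator A x * f x \<partial>M) \<le> C * measure M A"
    using C by (metis ennreal_le_iff measure_nonneg mult_nonneg_nonneg)
qed

end

section \<open>One step of the scheme\<close>

text \<open>A single backward step detached from the grid: \<open>G\<close> is the sigma-algebra at
  the left end point, \<open>X\<close> the value of \<open>Y\<close> at the right end point,
  \<open>K\<close> the Lipschitz constant in \<open>z\<close>. The bound \<open>m\<close> is a
  parameter because it is produced by a backward induction.\<close>

locale scheme_step = prob_space M + finite_measure_subalgebra M G
  for M G :: "'a measure" +
  fixes X :: "'a \<Rightarrow> real" and H Z :: "'a \<Rightarrow> real ^ 'd::finite" and m h c K :: real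
  assumes h: "0 < h" and c: "0 < c" and K: "0 < K"
    and X_meas: "X \<in> borel_measurable M" and X_bound: "AE x in M. \<bar>X x\<bar> \<le> m"
    and H_meas: "H \<in> borel_measurable M" and H_bound: "AE x in M. h * norm (H x) * K \<le> 1"
    and H_mean: "AE x in M. vec_cond_exp M G H x = 0"
    and H_cov: "AE x in M. mat c = h *\<^sub>R mat_cond_exp M G (\<lambda>x. outer (H x)) x"
    and Z_meas: "Z \<in> borel_measurable G"
    and Z_eq: "AE x in M. Z x = vec_cond_exp M G (\<lambda>x. X x *\<^sub>R H x) x"
begin

definition P :: "'a \<Rightarrow> real" where "P = real_cond_exp M G X"

lemma P_meas: "P \<in> borel_measurable G"
  by (simp add: P_def)

lemmas meas_M = measurable_from_subalg[OF subalg]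

lemma ess_bounded_X: "ess_bounded M X"
  using X_meas X_bound by (auto intro!: ess_boundedI)

lemma ess_bounded_H: "ess_bounded M H"
proof (rule ess_boundedI[OF H_meas])
  show "AE x in M. norm (H x) \<le> 1 / (h * K)"
    using H_bound by eventually_elim (use h K in \<open>simp add: field_simps\<close>)
qed

lemma H_nth_meas: "(\<lambda>x. H x $ j) \<in> borel_measurable M"
  using H_meas by (rule measurable_compose) simp

lemma H_mean_nth: "AE x in M. real_cond_exp M G (\<lambda>x. H x $ j) x = 0"
  using H_mean by eventually_elim (simp add: vec_cond_exp_def vec_eq_iff)

lemma H_cov_nth:
  "AE x in M. real_cond_exp M G (\<lambda>x. H x $ i * H x $ j) x = (if i = j then c / h else 0)"
  using H_cov
proof eventually_elim
  case (elim x)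
  then have "mat c $ i $ j = (h *\<^sub>R mat_cond_exp M G (\<lambda>x. outer (H x)) x) $ i $ j"
    by (rule arg_cong)
  then show ?case
    using h by (auto simp: mat_def mat_cond_exp_def outer_def field_simps)
qed

lemma Z_nth: "AE x in M. Z x $ j = real_cond_exp M G (\<lambda>x. X x * H x $ j) x"
  using Z_eq by eventually_elim (simp add: vec_cond_exp_def)

section \<open>Moments of \<open>H\<close> against bounded \<open>G\<close>-measurable
  weights\<close>

context
  fixes \<eta> :: "'a \<Rightarrow> real ^ 'd"
  assumes \<eta>: "\<eta> \<in> borel_measurable G" "ess_bounded M \<eta>"
begin

private lemma \<eta>_nth [measurable]: "(\<lambda>x. \<eta> x $ j) \<in> borel_measurable G"
  using \<eta>(1) by (rule measurable_compose) simp

lemma integral_inner_H: "(\<integral>x. \<eta> x \<bullet> H x \<partial>M) = 0"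
proof -
  have int: "integrable M (\<lambda>x. \<eta> x $ j * H x $ j)" for j
    by (intro integrable_ess_bounded ess_bounded_intros \<eta> ess_bounded_H)
  have "(\<integral>x. \<eta> x \<bullet> H x \<partial>M) = (\<Sum>j\<in>UNIV. \<integral>x. \<eta> x $ j * H x $ j \<partial>M)"
    by (simp add: inner_vec_def int)
  also have "\<dots> = (\<Sum>j\<in>UNIV. \<integral>x. \<eta> x $ j * real_cond_exp M G (\<lambda>x. H x $ j) x \<partial>M)"
    using int H_nth_meas by (intro sum.cong refl real_cond_exp_intg(2)[symmetric]) auto
  also have "\<dots> = (\<Sum>j\<in>(UNIV :: 'd set). \<integral>x. 0 \<partial>M)"
  proof (intro sum.cong refl integral_cong_AE)
    fix j
    show "AE x in M. \<eta> x $ j * real_cond_exp M G (\<lambda>x. H x $ j) x = 0"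
      using H_mean_nth[of j] by eventually_elim simp
  qed (auto intro!: borel_measurable_times meas_M[OF \<eta>_nth] borel_measurable_cond_exp2)
  finally show ?thesis by simp
qed

text \<open>Integrated form of the equation for \<open>Z\<close>. Integrability of
  \<open>\<eta> x \<bullet> Z x\<close> is obtained from that of the conditional expectations, as no
  bound on \<open>Z\<close> is available yet.\<close>

lemma integral_X_inner_H:
  "integrable M (\<lambda>x. \<eta> x \<bullet> Z x)" "(\<integral>x. X x * (\<eta> x \<bullet> H x) \<partial>M) = (\<integral>x. \<eta> x \<bullet> Z x \<partial>M)"
proof -
  have int: "integrable M (\<lambda>x. \<eta> x $ j * (X x * H x $ j))" for j
    by (intro integrable_ess_bounded ess_bounded_intros \<eta> ess_bounded_H ess_bounded_X)
  have meas: "(\<lambda>x. X x * H x $ j) \<in> borel_measurable M" for j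
    by (intro borel_measurable_times X_meas H_nth_meas)
  have Zm: "(\<lambda>x. Z x $ j) \<in> borel_measurable M" for j
    using meas_M[OF Z_meas] by (rule measurable_compose) simp
  have eq: "AE x in M. \<eta> x $ j * real_cond_exp M G (\<lambda>x. X x * H x $ j) x = \<eta> x $ j * Z x $ j" for j
    using Z_nth[of j] by eventually_elim simp
  have measl: "(\<lambda>x. \<eta> x $ j * real_cond_exp M G (\<lambda>x. X x * H x $ j) x) \<in> borel_measurable M" for j
    by (intro borel_measurable_times meas_M[OF \<eta>_nth] borel_measurable_cond_exp2)
  have measr: "(\<lambda>x. \<eta> x $ j * Z x $ j) \<in> borel_measurable M" for j
    by (intro borel_measurable_times meas_M[OF \<eta>_nth] Zm)
  have intZ: "integrable M (\<lambda>x. \<eta> x $ j * Z x $ j)" for j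
    using real_cond_exp_intg(1)[OF int \<eta>_nth meas] integrable_cong_AE[OF measl measr eq] by blast
  then show "integrable M (\<lambda>x. \<eta> x \<bullet> Z x)"
    by (simp add: inner_vec_def)
  have "(\<integral>x. X x * (\<eta> x \<bullet> H x) \<partial>M) = (\<Sum>j\<in>UNIV. \<integral>x. \<eta> x $ j * (X x * H x $ j) \<partial>M)"
    by (subst Bochner_Integration.integral_sum[symmetric, OF int])
      (simp add: inner_vec_def sum_distrib_left mult_ac)
  also have "\<dots> = (\<Sum>j\<in>UNIV. \<integral>x. \<eta> x $ j * real_cond_exp M G (\<lambda>x. X x * H x $ j) x \<partial>M)"
    using int meas by (intro sum.cong refl real_cond_exp_intg(2)[symmetric]) auto
  also have "\<dots> = (\<Sum>j\<in>UNIV. \<integral>x. \<eta> x $ j * Z x $ j \<partial>M)"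
    using measl measr eq by (intro sum.cong refl integral_cong_AE) auto
  also have "\<dots> = (\<integral>x. \<eta> x \<bullet> Z x \<partial>M)"
    by (simp add: inner_vec_def intZ)
  finally show "(\<integral>x. X x * (\<eta> x \<bullet> H x) \<partial>M) = (\<integral>x. \<eta> x \<bullet> Z x \<partial>M)" .
qed

text \<open>Given \<open>G\<close>, the second moment matrix of \<open>H\<close> is
  \<open>c / h\<close> times the identity, so only the diagonal terms of the expanded square
  survive.\<close>

lemma integral_inner_H_power2:
  assumes w: "w \<in> borel_measurable G" "ess_bounded M w"
  shows "(\<integral>x. w x * (\<eta> x \<bullet> H x)\<^sup>2 \<partial>M) = c / h * (\<integral>x. w x * (norm (\<eta> x))\<^sup>2 \<partial>M)"
proof -
  note [measurable] = w(1)
  have int: "integrable M (\<lambda>x. (w x * (\<eta> x $ i * \<eta> x $ j)) * (H x $ i * H x $ j))" for i j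
    by (intro integrable_ess_bounded ess_bounded_intros \<eta> w ess_bounded_H)
  have int2: "integrable M (\<lambda>x. w x * (\<eta> x $ j)\<^sup>2)" for j
    by (intro integrable_ess_bounded ess_bounded_intros \<eta> w)
  have meas: "(\<lambda>x. H x $ i * H x $ j) \<in> borel_measurable M" for i j
    by (intro borel_measurable_times H_nth_meas)
  have w\<eta>: "(\<lambda>x. w x * (\<eta> x $ i * \<eta> x $ j)) \<in> borel_measurable G" for i j
    by measurable
  have "(\<integral>x. w x * (\<eta> x \<bullet> H x)\<^sup>2 \<partial>M) =
      (\<integral>x. (\<Sum>i\<in>UNIV. \<Sum>j\<in>UNIV. (w x * (\<eta> x $ i * \<eta> x $ j)) * (H x $ i * H x $ j)) \<partial>M)"
    by (intro Bochner_Integration.integral_cong refl)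
      (simp add: inner_vec_def power2_eq_square sum_product sum_distrib_left mult_ac)
  also have "\<dots> = (\<Sum>i\<in>UNIV. \<Sum>j\<in>UNIV. \<integral>x. (w x * (\<eta> x $ i * \<eta> x $ j)) * (H x $ i * H x $ j) \<partial>M)"
    by (simp add: int)
  also have "\<dots> = (\<Sum>i\<in>UNIV. \<Sum>j\<in>UNIV.
      \<integral>x. (w x * (\<eta> x $ i * \<eta> x $ j)) * real_cond_exp M G (\<lambda>x. H x $ i * H x $ j) x \<partial>M)"
    using int meas w\<eta> by (intro sum.cong refl real_cond_exp_intg(2)[symmetric]) auto
  also have "\<dots> = (\<Sum>i\<in>UNIV. \<Sum>j\<in>UNIV.
      \<integral>x. (w x * (\<eta> x $ i * \<eta> x $ j)) * (if i = j then c / h else 0) \<partial>M)"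
  proof (intro sum.cong refl integral_cong_AE)
    fix i j
    show "AE x in M. (w x * (\<eta> x $ i * \<eta> x $ j)) * real_cond_exp M G (\<lambda>x. H x $ i * H x $ j) x =
        (w x * (\<eta> x $ i * \<eta> x $ j)) * (if i = j then c / h else 0)"
      using H_cov_nth[of i j] by eventually_elim simp
  qed (intro borel_measurable_times borel_measurable_const meas_M[OF \<eta>_nth] meas_M[OF w(1)]
      borel_measurable_cond_exp2)+
  also have "\<dots> = (\<Sum>i\<in>UNIV. c / h * (\<integral>x. w x * (\<eta> x $ i)\<^sup>2 \<partial>M))"
  proof (intro sum.cong refl)
    fix i
    have "(\<Sum>j\<in>UNIV. \<integral>x. (w x * (\<eta> x $ i * \<eta> x $ j)) * (if i = j then c / h else 0) \<partial>M) =
      (\<Sum>j\<in>UNIV. if i = j then c / h * (\<integral>x. w x * (\<eta> x $ i)\<^sup>2 \<partial>M) else 0)"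
      by (intro sum.cong refl) (auto simp: power2_eq_square mult_ac simp flip: integral_mult_right_zero)
    then show "(\<Sum>j\<in>UNIV. \<integral>x. (w x * (\<eta> x $ i * \<eta> x $ j)) * (if i = j then c / h else 0) \<partial>M) =
      c / h * (\<integral>x. w x * (\<eta> x $ i)\<^sup>2 \<partial>M)" by simp
  qed
  also have "\<dots> = c / h * (\<integral>x. (\<Sum>i\<in>UNIV. w x * (\<eta> x $ i)\<^sup>2) \<partial>M)"
    by (simp add: int2 sum_distrib_left)
  also have "(\<lambda>x. \<Sum>i\<in>UNIV. w x * (\<eta> x $ i)\<^sup>2) = (\<lambda>x. w x * (norm (\<eta> x))\<^sup>2)"
    unfolding power2_norm_eq_inner inner_vec_def by (simp add: sum_distrib_left power2_eq_square)
  finally show ?thesis .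
qed

end

section \<open>A priori bound for the conditional mean and for \<open>Z\<close>\<close>

lemma integral_weight_X:
  assumes "w \<in> borel_measurable G" "ess_bounded M w"
  shows "integrable M (\<lambda>x. w x * P x)" "(\<integral>x. w x * P x \<partial>M) = (\<integral>x. w x * X x \<partial>M)"
proof -
  have "integrable M (\<lambda>x. w x * X x)"
    by (intro integrable_ess_bounded ess_bounded_intros assms ess_bounded_X)
  from real_cond_exp_intg[OF this assms(1) X_meas]
  show "integrable M (\<lambda>x. w x * P x)" "(\<integral>x. w x * P x \<partial>M) = (\<integral>x. w x * X x \<partial>M)"
    by (simp_all add: P_def)
qed

lemma sets_G_M: "A \<in> sets G \<Longrightarrow> A \<in> sets M"
  using subalg by (auto simp: subalgebra_def)

text \<open>With the signs \<open>s\<close> of \<open>P\<close> and \<open>e\<close> of \<open>Z\<close>, the left-hand side is the conditional expectation of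
  \<open>X (s + h K e \<bullet> H)\<close>, and \<open>1 + s h K e \<bullet> H \<ge> 0\<close> has conditional mean \<open>1\<close>.\<close>

lemma P_Z_bound: "AE x in M. \<bar>P x\<bar> + h * K * norm (Z x) \<le> m"
proof -
  define s where "s x = (if 0 \<le> P x then 1 else -1 :: real)" for x
  \<comment> \<open>Since \<open>inverse 0 = 0\<close>, this is zero where \<open>Z\<close>
    vanishes, so that \<open>e x \<bullet> Z x = norm (Z x)\<close> holds everywhere.\<close>
  define e where "e x = inverse (norm (Z x)) *\<^sub>R Z x" for x
  note [measurable] = P_meas Z_meas
  have s_meas [measurable]: "s \<in> borel_measurable G" unfolding s_def by measurable
  have e_meas [measurable]: "e \<in> borel_measurable G" unfolding e_def by measurable
  have s_bdd: "ess_bounded M s"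
    by (rule ess_boundedI[OF meas_M[OF s_meas], of 1]) (auto simp: s_def)
  have e_le: "norm (e x) \<le> 1" for x by (simp add: e_def field_simps)
  have e_bdd: "ess_bounded M e"
    by (rule ess_boundedI[OF meas_M[OF e_meas], of 1]) (simp add: e_le)
  have sP: "s x * P x = \<bar>P x\<bar>" for x by (simp add: s_def)
  have eZ: "e x \<bullet> Z x = norm (Z x)" for x
    by (cases "Z x = 0") (simp_all add: e_def power2_eq_square flip: power2_norm_eq_inner)
  define f where "f x = m - \<bar>P x\<bar> - h * K * norm (Z x)" for x
  have "AE x in M. 0 \<le> f x"
  proof (rule AE_nonneg_if_integrals_nonneg)
    show "f \<in> borel_measurable G" unfolding f_def by measurable
    have "integrable M (\<lambda>x. m - s x * P x - h * K * (e x \<bullet> Z x))"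
      using integral_weight_X(1)[OF s_meas s_bdd] integral_X_inner_H(1)[OF e_meas e_bdd] by simp
    then show "integrable M f" by (simp add: f_def[abs_def] sP eZ)
    fix A assume A [measurable]: "A \<in> sets G"
    define iA where "iA = (indicator A :: 'a \<Rightarrow> real)"
    have iA [measurable]: "iA \<in> borel_measurable G" unfolding iA_def by measurable
    have iA_bdd: "ess_bounded M iA" unfolding iA_def by (intro ess_bounded_indicator sets_G_M A)
    have 1: "(\<lambda>x. iA x * s x) \<in> borel_measurable G" "ess_bounded M (\<lambda>x. iA x * s x)"
      by (measurable, intro ess_bounded_intros iA_bdd s_bdd)
    have 2: "(\<lambda>x. iA x *\<^sub>R e x) \<in> borel_measurable G" "ess_bounded M (\<lambda>x. iA x *\<^sub>R e x)"
      by (measurable, intro ess_bounded_intros iA_bdd e_bdd)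
    have 3: "(\<lambda>x. (iA x * s x) *\<^sub>R e x) \<in> borel_measurable G"
      "ess_bounded M (\<lambda>x. (iA x * s x) *\<^sub>R e x)"
      by (measurable, intro ess_bounded_intros iA_bdd e_bdd s_bdd)
    have "(\<integral>x. iA x * f x \<partial>M) =
      (\<integral>x. m * iA x - (iA x * s x) * P x - h * K * ((iA x *\<^sub>R e x) \<bullet> Z x) \<partial>M)"
      by (intro Bochner_Integration.integral_cong refl) (simp add: f_def sP eZ algebra_simps)
    \<comment> \<open>The last integral is zero because \<open>H\<close> has conditional mean zero;
      it is added to make the integrand factor.\<close>
    also have "\<dots> = m * (\<integral>x. iA x \<partial>M) - (\<integral>x. (iA x * s x) * X x \<partial>M)
        - h * K * (\<integral>x. X x * ((iA x *\<^sub>R e x) \<bullet> H x) \<partial>M)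
        + m * h * K * (\<integral>x. ((iA x * s x) *\<^sub>R e x) \<bullet> H x \<partial>M)"
      using integral_weight_X[OF 1] integral_X_inner_H[OF 2] integral_inner_H[OF 3]
        integrable_ess_bounded[OF iA_bdd] by simp
    also have "\<dots> = (\<integral>x. m * iA x - (iA x * s x) * X x
        - h * K * (X x * ((iA x *\<^sub>R e x) \<bullet> H x)) + m * h * K * (((iA x * s x) *\<^sub>R e x) \<bullet> H x) \<partial>M)"
      (is "_ = integral\<^sup>L M ?r")
      by (simp add: integrable_ess_bounded ess_bounded_intros 1 2 3 iA_bdd ess_bounded_X ess_bounded_H
          del: inner_scaleR_left)
    also have "0 \<le> \<dots>"
    proof (rule integral_nonneg_AE)
      show "AE x in M. 0 \<le> ?r x"
        using X_bound H_bound
      proof eventually_elim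
        case (elim x)
        define g where "g = h * K * (e x \<bullet> H x)"
        have "\<bar>e x \<bullet> H x\<bar> \<le> norm (H x)"
          using Cauchy_Schwarz_ineq2[of "e x" "H x"] mult_right_mono[OF e_le[of x], of "norm (H x)"]
          by simp
        then have "\<bar>g\<bar> \<le> h * K * norm (H x)"
          using h K by (simp add: g_def abs_mult)
        then have g: "\<bar>g\<bar> \<le> 1" using elim(2) by (simp add: mult_ac)
        have "?r x = iA x * (m * (1 + s x * g) - X x * (s x + g))"
          by (simp add: g_def algebra_simps)
        \<comment> \<open>The factorisation rests on \<open>s x\<close> being 1 or -1; both factors
          are nonnegative by \<open>|X| \<le> m\<close> and \<open>|g| \<le> 1\<close>.\<close>
        moreover have "m * (1 + s x * g) - X x * (s x + g) = (m - s x * X x) * (1 + s x * g)"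
          by (simp add: s_def algebra_simps)
        moreover have "0 \<le> (m - s x * X x) * (1 + s x * g)"
          using elim(1) g by (intro mult_nonneg_nonneg) (auto simp: s_def abs_le_iff)
        ultimately show ?case by (simp add: iA_def indicator_def)
      qed
    qed
    finally show "0 \<le> (\<integral>x. indicator A x * f x \<partial>M)" by (simp add: iA_def)
  qed
  then show ?thesis by eventually_elim (simp add: f_def)
qed

lemma ess_bounded_P: "ess_bounded M P"
proof (rule ess_boundedI[OF meas_M[OF P_meas]])
  show "AE x in M. norm (P x) \<le> m"
    using P_Z_bound
  proof eventually_elim
    case (elim x)
    moreover have "0 \<le> h * K * norm (Z x)" using h K by simp
    ultimately show ?case by simp
  qed
qed

lemma ess_bounded_Z: "ess_bounded M Z"
proof (rule ess_boundedI[OF meas_M[OF Z_meas]])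
  show "AE x in M. norm (Z x) \<le> m / (h * K)"
    using P_Z_bound
  proof eventually_elim
    case (elim x)
    then have "h * K * norm (Z x) \<le> m" by linarith
    then show ?case using h K by (simp add: field_simps)
  qed
qed

section \<open>Truncated slope of the driver and drift of the exponential\<close>

context
  fixes L :: real
  assumes L: "0 < L"
begin

text \<open>The maximiser of \<open>a * norm (Z x) - a^2 / (4 * L)\<close> over \<open>a\<close>
  between 0 and \<open>K\<close>; it is the factor \<gamma> of the change of measure.\<close>

definition slope :: "'a \<Rightarrow> real" where
  "slope x = min K (2 * L * norm (Z x))"

text \<open>\<open>R / h\<close> is the infimum over \<open>z\<close> of \<open>L |z|\<^sup>2 + K |Z - z|\<close>, that is, the best bound for the driver
  at \<open>Z\<close> that follows from quadratic growth and Lipschitz continuity together.\<close>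

definition R :: "'a \<Rightarrow> real" where
  "R x = h * (slope x * norm (Z x) - (slope x)\<^sup>2 / (4 * L))"

lemma slope_meas: "slope \<in> borel_measurable G"
  unfolding slope_def using Z_meas by measurable

lemma R_meas: "R \<in> borel_measurable G"
  unfolding R_def using Z_meas slope_meas by measurable

lemma slope_bounds: "0 \<le> slope x" "slope x \<le> K" "slope x \<le> 2 * L * norm (Z x)"
  using K L by (auto simp: slope_def)

lemma R_bounds: "0 \<le> R x" "R x \<le> h * K * norm (Z x)"
proof -
  have "slope x * slope x \<le> slope x * (2 * L * norm (Z x))"
    by (intro mult_left_mono slope_bounds)
  then have "(slope x)\<^sup>2 / (4 * L) \<le> slope x * norm (Z x) / 2"
    using L by (simp add: field_simps power2_eq_square)
  moreover have "0 \<le> slope x * norm (Z x)" using slope_bounds by simp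
  ultimately show "0 \<le> R x" using h by (simp add: R_def)
  have "R x \<le> h * (slope x * norm (Z x))" using h L by (simp add: R_def)
  also have "\<dots> \<le> h * (K * norm (Z x))"
    using h slope_bounds by (intro mult_left_mono mult_right_mono) auto
  finally show "R x \<le> h * K * norm (Z x)" by (simp add: mult_ac)
qed

lemma ess_bounded_slope: "ess_bounded M slope"
  using slope_bounds by (intro ess_boundedI[OF meas_M[OF slope_meas], of K]) simp

lemma ess_bounded_R: "ess_bounded M R"
  unfolding R_def[abs_def] divide_inverse
  by (intro ess_bounded_intros ess_bounded_slope ess_bounded_Z)

text \<open>Where the derivative \<open>2 * L * norm (Z x)\<close> of the quadratic bound is at most
  \<open>K\<close>, growth at \<open>Z x\<close> suffices. Otherwise growth is used at a point
  closer to 0 and Lipschitz continuity covers the way from there to \<open>Z x\<close>.\<close>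

lemma driver_le_R:
  fixes f :: "real ^ 'd \<Rightarrow> real"
  assumes lip: "\<And>z z'. \<bar>f z - f z'\<bar> \<le> K * norm (z - z')"
    and growth: "\<And>z. \<bar>f z\<bar> \<le> a + L * (norm z)\<^sup>2"
  shows "h * f (Z x) \<le> R x + h * a"
proof -
  have "f (Z x) \<le> slope x * norm (Z x) - (slope x)\<^sup>2 / (4 * L) + a"
  proof (cases "2 * L * norm (Z x) \<le> K")
    case True
    then have "slope x = 2 * L * norm (Z x)" by (simp add: slope_def)
    moreover have "f (Z x) \<le> a + L * (norm (Z x))\<^sup>2" using growth[of "Z x"] by simp
    ultimately show ?thesis using L by (simp add: field_simps power2_eq_square)
  next
    case False
    \<comment> \<open>Shrinks \<open>Z x\<close> to norm \<open>K / (2 * L)\<close>, where the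
      derivative of the quadratic bound equals \<open>K\<close>.\<close>
    define r where "r = K / (2 * L * norm (Z x))"
    have Z: "norm (Z x) \<noteq> 0" using False K by auto
    have r: "0 \<le> r" "r \<le> 1" "r * norm (Z x) = K / (2 * L)"
      using False K L Z by (auto simp: r_def field_simps)
    have "Z x - r *\<^sub>R Z x = (1 - r) *\<^sub>R Z x" by (simp add: algebra_simps)
    then have n: "norm (Z x - r *\<^sub>R Z x) = (1 - r) * norm (Z x)" using r by simp
    have n2: "norm (r *\<^sub>R Z x) = K / (2 * L)" using r by simp
    have "f (Z x) \<le> (a + L * (norm (r *\<^sub>R Z x))\<^sup>2) + K * norm (Z x - r *\<^sub>R Z x)"
      using lip[of "Z x" "r *\<^sub>R Z x"] growth[of "r *\<^sub>R Z x"] by linarith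
    also have "K * norm (Z x - r *\<^sub>R Z x) = K * (norm (Z x) - K / (2 * L))"
      unfolding n using r(3) by (simp add: algebra_simps)
    also have "a + L * (norm (r *\<^sub>R Z x))\<^sup>2 + K * (norm (Z x) - K / (2 * L)) =
        K * norm (Z x) - K\<^sup>2 / (4 * L) + a"
      unfolding n2 using L by (simp add: field_simps power2_eq_square)
    finally show ?thesis using False by (simp add: slope_def)
  qed
  from mult_left_mono[OF this, of h] h show ?thesis by (simp add: R_def algebra_simps)
qed

text \<open>The drift inequality with conditional expectations replaced by integrals over sets of
  \<open>G\<close>. The exponent contains \<open>P + R\<close> because this dominates
  \<open>Y\<close> up to the terms from \<open>Ky\<close> and the growth variable.\<close>

lemma exp_drift:
  fixes \<alpha> \<kappa> :: real
  assumes \<alpha>: "8 * L * c \<le> \<alpha>" and A: "A \<in> sets G"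
  defines "\<kappa> \<equiv> (exp (- (3 * \<alpha> * m)))\<^sup>2 / 16 * \<alpha>\<^sup>2 * (h / c)"
  shows "(\<integral>x. indicator A x * exp (\<alpha> * (P x + R x)) \<partial>M)
      + \<kappa> * exp (- (\<alpha> * m)) * (\<integral>x. indicator A x * (norm (Z x))\<^sup>2 \<partial>M)
    \<le> (\<integral>x. indicator A x * exp (\<alpha> * X x) \<partial>M)"
proof -
  have \<alpha>_pos: "0 < \<alpha>" using \<alpha> L c by (meson less_le_trans mult_pos_pos zero_less_numeral)
  define k where "k = (exp (- (3 * \<alpha> * m)))\<^sup>2 / 16 * \<alpha>\<^sup>2"
  have \<kappa>: "\<kappa> = k * (h / c)" "0 \<le> k" by (auto simp: k_def \<kappa>_def)
  define \<eta> where "\<eta> x = slope x *\<^sub>R sgn (Z x)" for x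
  define g where "g x = h * (\<eta> x \<bullet> H x)" for x
  \<comment> \<open>This choice maximises
    \<open>2 \<zeta> \<bullet> Z - (c / h) |\<zeta>|^2\<close>, the conditional mean of the last
    bracket in \<open>low\<close>; the maximum is \<open>(h / c) |Z|^2\<close>.\<close>
  define \<zeta> where "\<zeta> x = (h / c) *\<^sub>R Z x" for x
  define w where "w x = indicator A x * exp (\<alpha> * (P x + R x))" for x
  note [measurable] = P_meas Z_meas slope_meas R_meas A
  have \<eta>_meas [measurable]: "\<eta> \<in> borel_measurable G"
    unfolding \<eta>_def sgn_div_norm by measurable
  have w_meas [measurable]: "w \<in> borel_measurable G" unfolding w_def by measurable
  have \<zeta>_meas [measurable]: "\<zeta> \<in> borel_measurable G" unfolding \<zeta>_def by measurable
  have norm_\<eta>: "norm (\<eta> x) = slope x" for x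
    using slope_bounds[of x] by (cases "Z x = 0") (simp_all add: \<eta>_def norm_sgn)
  have \<eta>_Z: "\<eta> x \<bullet> Z x = slope x * norm (Z x)" for x
    by (cases "Z x = 0") (simp_all add: \<eta>_def sgn_div_norm power2_eq_square flip: power2_norm_eq_inner)
  have \<eta>_bdd: "ess_bounded M \<eta>"
    using slope_bounds by (intro ess_boundedI[OF meas_M[OF \<eta>_meas], of K]) (simp add: norm_\<eta>)
  have \<zeta>_bdd: "ess_bounded M \<zeta>"
    unfolding \<zeta>_def[abs_def] by (intro ess_bounded_intros ess_bounded_Z)
  have w_bdd: "ess_bounded M w"
    unfolding w_def[abs_def]
    by (intro ess_bounded_intros ess_bounded_indicator sets_G_M A ess_bounded_P ess_bounded_R)
  note bdd = \<eta>_bdd \<zeta>_bdd w_bdd ess_bounded_R ess_bounded_slope ess_bounded_X ess_bounded_P ess_bounded_Z ess_bounded_H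
  \<comment> \<open>The pointwise lower bound for the exponential, with the square of
    \<open>X - P - R\<close> replaced by its minorant \<open>2 a b - b^2\<close>, where
    \<open>b = \<zeta> \<bullet> H\<close>. Its integral then involves only known moments of
    \<open>H\<close>.\<close>
  define low where "low x = w x * (1 + (1 + g x) * (\<alpha> * (X x - P x - R x)) - 2 * (g x)\<^sup>2
    + k * (2 * (X x - P x - R x) * (\<zeta> x \<bullet> H x) - (\<zeta> x \<bullet> H x)\<^sup>2))" for x
  have low_le: "AE x in M. low x \<le> indicator A x * exp (\<alpha> * X x)"
    using X_bound H_bound P_Z_bound
  proof eventually_elim
    case (elim x)
    define v where "v = \<alpha> * (X x - P x - R x)"
    \<comment> \<open>\<open>R_bounds\<close> and \<open>P_Z_bound\<close> together give
      \<open>|P| + R \<le> m\<close>.\<close>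
    have "\<bar>X x - P x - R x\<bar> \<le> 3 * m"
      using elim R_bounds[of x] by linarith
    then have v: "\<bar>v\<bar> \<le> 3 * \<alpha> * m"
      using \<alpha>_pos by (simp add: v_def abs_mult)
    have "\<bar>\<eta> x \<bullet> H x\<bar> \<le> slope x * norm (H x)"
      using Cauchy_Schwarz_ineq2[of "\<eta> x" "H x"] by (simp add: norm_\<eta>)
    also have "\<dots> \<le> K * norm (H x)" by (intro mult_right_mono slope_bounds) simp
    finally have "\<bar>g x\<bar> \<le> h * (K * norm (H x))" using h by (simp add: g_def abs_mult)
    then have g: "\<bar>g x\<bar> \<le> 1" using elim(2) by (simp add: mult_ac)
    have sq: "2 * (X x - P x - R x) * (\<zeta> x \<bullet> H x) - (\<zeta> x \<bullet> H x)\<^sup>2 \<le> (X x - P x - R x)\<^sup>2"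
      using zero_le_power2[of "(X x - P x - R x) - \<zeta> x \<bullet> H x"]
      by (simp add: power2_eq_square algebra_simps)
    have "low x \<le> w x * (1 + (1 + g x) * v - 2 * (g x)\<^sup>2 + (exp (- (3 * \<alpha> * m)))\<^sup>2 / 16 * v\<^sup>2)"
      unfolding low_def
      using mult_left_mono[OF sq \<kappa>(2)]
      by (intro mult_left_mono) (auto simp: w_def v_def k_def power_mult_distrib mult_ac)
    also have "\<dots> \<le> w x * exp v"
      by (intro mult_left_mono exp_ge_entropy_quadratic v g) (simp add: w_def)
    also have "\<dots> = indicator A x * exp (\<alpha> * X x)"
      by (simp add: w_def v_def algebra_simps flip: exp_add)
    finally show ?case .
  qed
  have low_eq: "low x = w x + \<alpha> * (w x * X x) - \<alpha> * (w x * P x) - \<alpha> * (w x * R x)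
     + \<alpha> * h * (X x * ((w x *\<^sub>R \<eta> x) \<bullet> H x)) - \<alpha> * h * (((w x * (P x + R x)) *\<^sub>R \<eta> x) \<bullet> H x)
     - 2 * h\<^sup>2 * (w x * (\<eta> x \<bullet> H x)\<^sup>2)
     + 2 * k * (X x * ((w x *\<^sub>R \<zeta> x) \<bullet> H x)) - 2 * k * (((w x * (P x + R x)) *\<^sub>R \<zeta> x) \<bullet> H x)
     - k * (w x * (\<zeta> x \<bullet> H x)\<^sup>2)" for x
    unfolding low_def g_def by (simp add: algebra_simps power2_eq_square)
  have 1: "(\<lambda>x. w x *\<^sub>R \<eta> x) \<in> borel_measurable G" "ess_bounded M (\<lambda>x. w x *\<^sub>R \<eta> x)"
    by (measurable, intro ess_bounded_intros bdd)
  have 2: "(\<lambda>x. w x *\<^sub>R \<zeta> x) \<in> borel_measurable G" "ess_bounded M (\<lambda>x. w x *\<^sub>R \<zeta> x)"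
    by (measurable, intro ess_bounded_intros bdd)
  have 3: "(\<lambda>x. (w x * (P x + R x)) *\<^sub>R \<eta> x) \<in> borel_measurable G"
    "ess_bounded M (\<lambda>x. (w x * (P x + R x)) *\<^sub>R \<eta> x)"
    by (measurable, intro ess_bounded_intros bdd)
  have 4: "(\<lambda>x. (w x * (P x + R x)) *\<^sub>R \<zeta> x) \<in> borel_measurable G"
    "ess_bounded M (\<lambda>x. (w x * (P x + R x)) *\<^sub>R \<zeta> x)"
    by (measurable, intro ess_bounded_intros bdd)
  have "(\<integral>x. low x \<partial>M) = (\<integral>x. w x \<partial>M) + \<alpha> * (\<integral>x. w x * X x \<partial>M) - \<alpha> * (\<integral>x. w x * P x \<partial>M)
     - \<alpha> * (\<integral>x. w x * R x \<partial>M)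
     + \<alpha> * h * (\<integral>x. X x * ((w x *\<^sub>R \<eta> x) \<bullet> H x) \<partial>M)
     - \<alpha> * h * (\<integral>x. ((w x * (P x + R x)) *\<^sub>R \<eta> x) \<bullet> H x \<partial>M)
     - 2 * h\<^sup>2 * (\<integral>x. w x * (\<eta> x \<bullet> H x)\<^sup>2 \<partial>M)
     + 2 * k * (\<integral>x. X x * ((w x *\<^sub>R \<zeta> x) \<bullet> H x) \<partial>M)
     - 2 * k * (\<integral>x. ((w x * (P x + R x)) *\<^sub>R \<zeta> x) \<bullet> H x \<partial>M)
     - k * (\<integral>x. w x * (\<zeta> x \<bullet> H x)\<^sup>2 \<partial>M)"
    unfolding low_eq
    by (simp add: integrable_ess_bounded ess_bounded_intros bdd del: inner_scaleR_left)
  \<comment> \<open>The integrals of \<open>w X\<close> and \<open>w P\<close> cancel, and the terms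
    linear in \<open>H\<close> without \<open>X\<close> vanish.\<close>
  also have "\<dots> = (\<integral>x. w x \<partial>M) - \<alpha> * (\<integral>x. w x * R x \<partial>M)
     + \<alpha> * h * (\<integral>x. (w x *\<^sub>R \<eta> x) \<bullet> Z x \<partial>M)
     - 2 * h\<^sup>2 * (c / h * (\<integral>x. w x * (norm (\<eta> x))\<^sup>2 \<partial>M))
     + 2 * k * (\<integral>x. (w x *\<^sub>R \<zeta> x) \<bullet> Z x \<partial>M)
     - k * (c / h * (\<integral>x. w x * (norm (\<zeta> x))\<^sup>2 \<partial>M))"
    unfolding integral_weight_X(2)[OF w_meas w_bdd] integral_X_inner_H(2)[OF 1]
      integral_X_inner_H(2)[OF 2] integral_inner_H[OF 3] integral_inner_H[OF 4]
      integral_inner_H_power2[OF \<eta>_meas \<eta>_bdd w_meas w_bdd]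
      integral_inner_H_power2[OF \<zeta>_meas \<zeta>_bdd w_meas w_bdd]
    by simp
  also have "\<dots> = (\<integral>x. w x - \<alpha> * (w x * R x) + \<alpha> * h * (w x * (slope x * norm (Z x)))
      - 2 * h * c * (w x * (slope x)\<^sup>2)
      + \<kappa> * (w x * (norm (Z x))\<^sup>2) \<partial>M)"
  proof -
    have e1: "(w x *\<^sub>R \<eta> x) \<bullet> Z x = w x * (slope x * norm (Z x))" for x by (simp add: \<eta>_Z)
    have e2: "(w x *\<^sub>R \<zeta> x) \<bullet> Z x = h / c * (w x * (norm (Z x))\<^sup>2)" for x
      by (simp add: \<zeta>_def power2_norm_eq_inner)
    have e3: "w x * (norm (\<zeta> x))\<^sup>2 = (h / c)\<^sup>2 * (w x * (norm (Z x))\<^sup>2)" for x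
      by (simp add: \<zeta>_def power_mult_distrib power_divide)
    show ?thesis
      unfolding e1 e2 e3 norm_\<eta> \<kappa>(1) using h c
      by (simp add: integrable_ess_bounded ess_bounded_intros bdd)
        (simp add: field_simps power2_eq_square)
  qed
  also have "\<dots> \<ge> (\<integral>x. w x + \<kappa> * exp (- (\<alpha> * m)) * (indicator A x * (norm (Z x))\<^sup>2) \<partial>M)"
    (is "_ \<ge> integral\<^sup>L M ?l")
  proof (rule integral_mono_AE)
    show "AE x in M. ?l x \<le> w x - \<alpha> * (w x * R x) + \<alpha> * h * (w x * (slope x * norm (Z x)))
      - 2 * h * c * (w x * (slope x)\<^sup>2) + \<kappa> * (w x * (norm (Z x))\<^sup>2)"
      using P_Z_bound
    proof eventually_elim
      case (elim x)
      have "- m \<le> P x + R x" using elim R_bounds[of x] by linarith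
      then have "exp (- (\<alpha> * m)) \<le> exp (\<alpha> * (P x + R x))"
        using mult_left_mono[of "- m" "P x + R x" \<alpha>] \<alpha>_pos by simp
      then have "indicator A x * exp (- (\<alpha> * m)) \<le> w x"
        unfolding w_def by (intro mult_left_mono) auto
      then have 1: "\<kappa> * ((indicator A x * exp (- (\<alpha> * m))) * (norm (Z x))\<^sup>2) \<le> \<kappa> * (w x * (norm (Z x))\<^sup>2)"
        using \<kappa> h c by (intro mult_left_mono mult_right_mono) auto
      \<comment> \<open>The size of \<alpha> enters here: the gap
        \<open>h * (slope x)^2 / (4 * L)\<close> between \<open>h * slope x * norm (Z x)\<close> and
        \<open>R x\<close>, multiplied by \<alpha>, pays for the loss \<open>2 g^2\<close>.\<close>
      have "2 * h * c * (slope x)\<^sup>2 \<le> \<alpha> * h * (slope x)\<^sup>2 / (4 * L)"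
        using mult_right_mono[OF \<alpha>, of "h * (slope x)\<^sup>2"] h L by (simp add: field_simps)
      then have "0 \<le> w x * (\<alpha> * h * (slope x)\<^sup>2 / (4 * L) - 2 * h * c * (slope x)\<^sup>2)"
        by (simp add: w_def)
      also have "\<dots> = - \<alpha> * (w x * R x) + \<alpha> * h * (w x * (slope x * norm (Z x)))
        - 2 * h * c * (w x * (slope x)\<^sup>2)"
        unfolding R_def by (simp add: algebra_simps)
      finally show ?case using 1 by (simp add: mult_ac)
    qed
  qed (intro integrable_ess_bounded ess_bounded_intros bdd ess_bounded_indicator sets_G_M A)+
  also have "(\<integral>x. w x + \<kappa> * exp (- (\<alpha> * m)) * (indicator A x * (norm (Z x))\<^sup>2) \<partial>M) =
    (\<integral>x. w x \<partial>M) + \<kappa> * exp (- (\<alpha> * m)) * (\<integral>x. indicator A x * (norm (Z x))\<^sup>2 \<partial>M)"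
    by (simp add: integrable_ess_bounded ess_bounded_intros bdd ess_bounded_indicator sets_G_M A)
  finally have "(\<integral>x. w x \<partial>M) + \<kappa> * exp (- (\<alpha> * m)) * (\<integral>x. indicator A x * (norm (Z x))\<^sup>2 \<partial>M)
    \<le> (\<integral>x. low x \<partial>M)" .
  also have "\<dots> \<le> (\<integral>x. indicator A x * exp (\<alpha> * X x) \<partial>M)"
  proof (rule integral_mono_AE[OF _ _ low_le])
    show "integrable M low" unfolding low_def[abs_def] g_def
      by (intro integrable_ess_bounded ess_bounded_intros bdd)
    show "integrable M (\<lambda>x. indicator A x * exp (\<alpha> * X x))"
      by (intro integrable_ess_bounded ess_bounded_intros bdd ess_bounded_indicator sets_G_M A)
  qed
  finally show ?thesis by (simp add: w_def)
qed

end

section \<open>The implicit equation for \<open>Y\<close>\<close>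

lemma solution_eq:
  assumes "f \<in> borel_measurable G" "integrable M (\<lambda>x. X x + h * f x)"
    and Y: "AE x in M. Y x = real_cond_exp M G (\<lambda>x. X x + h * f x) x"
  shows "AE x in M. Y x = P x + h * f x"
proof -
  have X: "integrable M X" by (intro integrable_ess_bounded ess_bounded_X)
  \<comment> \<open>Integrability is given for the sum only; as \<open>X\<close> is bounded, it
    passes to the driver term, which then leaves the conditional expectation.\<close>
  have "integrable M (\<lambda>x. (X x + h * f x) - X x)"
    using assms(2) X by (rule Bochner_Integration.integrable_diff)
  then have hf: "integrable M (\<lambda>x. h * f x)" by simp
  have "AE x in M. real_cond_exp M G (\<lambda>x. h * f x) x = h * f x"
    using hf assms(1) by (intro real_cond_exp_F_meas) auto
  with Y real_cond_exp_add[OF X hf] show ?thesis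
    by eventually_elim (simp add: P_def)
qed

text \<open>The part \<open>h * K * norm (Z x)\<close> of the driver is already contained in the
  bound \<open>m\<close> of \<open>P_Z_bound\<close>, and \<open>h * Ky * |Y|\<close> moves to the
  left-hand side.\<close>

lemma solution_bound:
  fixes F :: "'a \<Rightarrow> real \<Rightarrow> real ^ 'd \<Rightarrow> real"
  assumes Y: "AE x in M. Y x = P x + h * F x (Y x) (Z x)"
    and lip: "AE x in M. \<forall>y y' z z'. \<bar>F x y z - F x y' z'\<bar> \<le> Ky * \<bar>y - y'\<bar> + K * norm (z - z')"
    and F0: "AE x in M. \<bar>F x 0 0\<bar> \<le> C0"
    and Ky: "0 \<le> Ky" "h * Ky \<le> 1 - \<epsilon>" "0 < \<epsilon>"
  shows "AE x in M. \<bar>Y x\<bar> \<le> exp (h * Ky / \<epsilon>) * (m + h * C0)"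
  using Y lip F0 P_Z_bound
proof eventually_elim
  case (elim x)
  let ?f = "F x (Y x) (Z x)"
  have "\<bar>?f - F x 0 0\<bar> \<le> Ky * \<bar>Y x\<bar> + K * norm (Z x)"
    using elim(2)[rule_format, of "Y x" "Z x" 0 0] by simp
  then have "\<bar>?f\<bar> \<le> Ky * \<bar>Y x\<bar> + K * norm (Z x) + C0" using elim(3) by linarith
  then have "h * \<bar>?f\<bar> \<le> h * (Ky * \<bar>Y x\<bar> + K * norm (Z x) + C0)"
    using h by (intro mult_left_mono) auto
  moreover have "\<bar>Y x\<bar> \<le> \<bar>P x\<bar> + h * \<bar>?f\<bar>"
    using elim(1) h abs_triangle_ineq[of "P x" "h * ?f"] by (simp add: abs_mult)
  ultimately have 1: "\<bar>Y x\<bar> * (1 - h * Ky) \<le> m + h * C0"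
    using elim(4) by (simp add: algebra_simps)
  have q: "0 < 1 - h * Ky" using Ky by linarith
  have "0 \<le> m + h * C0" using 1 q by (meson abs_ge_zero mult_nonneg_nonneg less_imp_le order_trans)
  \<comment> \<open>An exponential bound is sought because its product over the steps depends only
    on the total time; \<open>1 - h * Ky \<ge> \<epsilon>\<close> provides it.\<close>
  have "1 / (1 - h * Ky) = 1 + h * Ky / (1 - h * Ky)" using q by (simp add: field_simps)
  also have "\<dots> \<le> 1 + h * Ky / \<epsilon>"
    using Ky h by (intro add_left_mono divide_left_mono) auto
  also have "\<dots> \<le> exp (h * Ky / \<epsilon>)" by (rule exp_ge_add_one_self)
  finally have "1 / (1 - h * Ky) * (m + h * C0) \<le> exp (h * Ky / \<epsilon>) * (m + h * C0)"
    using \<open>0 \<le> m + h * C0\<close> by (rule mult_right_mono)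
  moreover have "\<bar>Y x\<bar> \<le> 1 / (1 - h * Ky) * (m + h * C0)" using 1 q by (simp add: field_simps)
  ultimately show ?case by linarith
qed

text \<open>\<open>driver_le_R\<close> with \<open>Ky * m + |s|\<close> as constant term gives
  \<open>Y - a \<le> P + R\<close> for a small error \<open>a\<close>. By
  \<open>exp (- u) \<ge> 1 - u\<close>, removing \<open>a\<close> from the exponent costs at most
  \<open>\<alpha> * a * exp (\<alpha> * m)\<close>, and \<open>exp_drift\<close> applies.\<close>

lemma solution_drift:
  fixes F :: "'a \<Rightarrow> real \<Rightarrow> real ^ 'd \<Rightarrow> real"
  assumes Y: "AE x in M. Y x = P x + h * F x (Y x) (Z x)"
    and Y_meas: "Y \<in> borel_measurable M" and Y_bound: "AE x in M. \<bar>Y x\<bar> \<le> m"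
    and lip: "AE x in M. \<forall>y y' z z'. \<bar>F x y z - F x y' z'\<bar> \<le> Ky * \<bar>y - y'\<bar> + K * norm (z - z')"
    and growth: "AE x in M. \<forall>y z. \<bar>F x y z\<bar> \<le> Ky * \<bar>y\<bar> + L * (norm z)\<^sup>2 + s x"
    and s: "integrable M s"
    and Ky: "0 \<le> Ky" and L: "0 < L" and \<alpha>: "8 * L * c \<le> \<alpha>" and A: "A \<in> sets G"
  shows "(exp (- (3 * \<alpha> * m)))\<^sup>2 / 16 * \<alpha>\<^sup>2 * (h / c) * exp (- (\<alpha> * m)) *
      (\<integral>x. indicator A x * (norm (Z x))\<^sup>2 \<partial>M)
    \<le> (\<integral>x. indicator A x * exp (\<alpha> * X x) \<partial>M) - (\<integral>x. indicator A x * exp (\<alpha> * Y x) \<partial>M)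
      + \<alpha> * exp (\<alpha> * m) * (h * Ky * m * measure M A + (\<integral>x. indicator A x * (h * \<bar>s x\<bar>) \<partial>M))"
proof -
  have \<alpha>_pos: "0 < \<alpha>" using \<alpha> L c by (meson less_le_trans mult_pos_pos zero_less_numeral)
  have AM: "A \<in> sets M" using A by (rule sets_G_M)
  have Y_bdd: "ess_bounded M Y" using Y_meas Y_bound by (auto intro!: ess_boundedI)
  have int1: "integrable M (\<lambda>x. indicator A x * exp (\<alpha> * (P x + R L x)))"
    by (intro integrable_ess_bounded ess_bounded_intros ess_bounded_indicator AM ess_bounded_P ess_bounded_R[OF L])
  have int2: "integrable M (\<lambda>x. indicator A x * exp (\<alpha> * Y x))"
    by (intro integrable_ess_bounded ess_bounded_intros ess_bounded_indicator AM Y_bdd)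
  have int3: "integrable M (\<lambda>x. indicator A x * (h * \<bar>s x\<bar>))"
    using integrable_mult_indicator[OF AM, of "\<lambda>x. h * \<bar>s x\<bar>"] s by simp
  have int4: "integrable M (\<lambda>x. h * Ky * m * indicator A x)"
    by (intro integrable_ess_bounded ess_bounded_intros ess_bounded_indicator AM)
  have "AE x in M. indicator A x * exp (\<alpha> * Y x) -
      \<alpha> * exp (\<alpha> * m) * (h * Ky * m * indicator A x + indicator A x * (h * \<bar>s x\<bar>))
    \<le> indicator A x * exp (\<alpha> * (P x + R L x))"
    using Y Y_bound lip growth
  proof eventually_elim
    case (elim x)
    define a where "a = h * (Ky * m + \<bar>s x\<bar>)"
    have m: "0 \<le> m" using elim(2) by linarith
    have "0 \<le> a" using h Ky m by (simp add: a_def)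
    have "h * F x (Y x) (Z x) \<le> R L x + h * (Ky * m + \<bar>s x\<bar>)"
    proof (rule driver_le_R[OF L, of "F x (Y x)"])
      show "\<bar>F x (Y x) z - F x (Y x) z'\<bar> \<le> K * norm (z - z')" for z z'
        using elim(3)[rule_format, of "Y x" z "Y x" z'] by simp
      show "\<bar>F x (Y x) z\<bar> \<le> (Ky * m + \<bar>s x\<bar>) + L * (norm z)\<^sup>2" for z
        using elim(4)[rule_format, of "Y x" z] mult_left_mono[OF elim(2) Ky] by linarith
    qed
    then have "Y x - a \<le> P x + R L x" using elim(1) by (simp add: a_def)
    then have "exp (\<alpha> * (Y x - a)) \<le> exp (\<alpha> * (P x + R L x))" using \<alpha>_pos by simp
    moreover have "exp (\<alpha> * Y x) - \<alpha> * a * exp (\<alpha> * m) \<le> exp (\<alpha> * (Y x - a))"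
    proof -
      have "exp (\<alpha> * Y x) * (1 - \<alpha> * a) \<le> exp (\<alpha> * Y x) * exp (- (\<alpha> * a))"
        using exp_ge_add_one_self[of "- (\<alpha> * a)"] by (intro mult_left_mono) auto
      also have "\<dots> = exp (\<alpha> * (Y x - a))" by (simp add: right_diff_distrib flip: exp_add)
      finally have "exp (\<alpha> * Y x) - \<alpha> * a * exp (\<alpha> * Y x) \<le> exp (\<alpha> * (Y x - a))"
        by (simp add: algebra_simps)
      moreover have "\<alpha> * a * exp (\<alpha> * Y x) \<le> \<alpha> * a * exp (\<alpha> * m)"
        using elim(2) \<alpha>_pos \<open>0 \<le> a\<close> by (intro mult_left_mono) auto
      ultimately show ?thesis by linarith
    qed
    ultimately have "exp (\<alpha> * Y x) - \<alpha> * a * exp (\<alpha> * m) \<le> exp (\<alpha> * (P x + R L x))" by linarith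
    then show ?case by (simp add: indicator_def a_def algebra_simps)
  qed
  then have "(\<integral>x. indicator A x * exp (\<alpha> * Y x) -
      \<alpha> * exp (\<alpha> * m) * (h * Ky * m * indicator A x + indicator A x * (h * \<bar>s x\<bar>)) \<partial>M)
    \<le> (\<integral>x. indicator A x * exp (\<alpha> * (P x + R L x)) \<partial>M)"
    by (intro integral_mono_AE int1 Bochner_Integration.integrable_diff int2
      integrable_mult_right Bochner_Integration.integrable_add int3 int4)
  moreover have "(\<integral>x. indicator A x * exp (\<alpha> * Y x) -
      \<alpha> * exp (\<alpha> * m) * (h * Ky * m * indicator A x + indicator A x * (h * \<bar>s x\<bar>)) \<partial>M)
    = (\<integral>x. indicator A x * exp (\<alpha> * Y x) \<partial>M)
      - \<alpha> * exp (\<alpha> * m) * (h * Ky * m * measure M A + (\<integral>x. indicator A x * (h * \<bar>s x\<bar>) \<partial>M))"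
    unfolding Bochner_Integration.integral_diff[OF int2 integrable_mult_right[OF
        Bochner_Integration.integrable_add[OF int4 int3]]]
      integral_mult_right_zero Bochner_Integration.integral_add[OF int4 int3]
    using AM by simp
  ultimately show ?thesis using exp_drift[OF L \<alpha> A] by linarith
qed

end

section \<open>The Brownian filtration\<close>

lemma space_brownian_filtration: "space (brownian_filtration M W s) = space M"
  unfolding brownian_filtration_def
  by (rule space_measure_of) (auto dest: null_setsD2 sets.sets_into_space)

lemma sets_brownian_filtration:
  "sets (brownian_filtration M W s) = sigma_sets (space M)
     ({W r -` A \<inter> space M | r A. r \<in> {0..s} \<and> A \<in> sets borel} \<union> null_sets M)"
  unfolding brownian_filtration_def
  by (rule sets_measure_of) (auto dest: null_setsD2 sets.sets_into_space)

text \<open>The generators are preimages under \<open>W r\<close> with \<open>r \<le> T\<close> and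
  null sets of \<open>M\<close>, all measurable in \<open>M\<close>.\<close>

lemma subalgebra_brownian_filtration:
  assumes "brownian_motion M T W" "s \<le> T"
  shows "subalgebra M (brownian_filtration M W s)"
  unfolding subalgebra_def space_brownian_filtration sets_brownian_filtration
  using assms by (auto intro!: sets.sigma_sets_subset measurable_sets simp: brownian_motion_def)

lemma brownian_filtration_mono:
  "r \<le> s \<Longrightarrow> sets (brownian_filtration M W r) \<subseteq> sets (brownian_filtration M W s)"
  unfolding sets_brownian_filtration by (intro sigma_sets_mono') fastforce

section \<open>The scheme on a fixed grid\<close>

text \<open>Discrete Gronwall bound, used with the remaining time in place of \<open>T\<close>. The
  absolute values allow constants \<open>C0\<close> and \<open>C1\<close> of any sign.\<close>

definition sup_bound :: "real \<Rightarrow> real \<Rightarrow> real \<Rightarrow> real \<Rightarrow> real \<Rightarrow> real" where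
  "sup_bound Ky \<epsilon> C0 C1 T = exp (T * Ky / \<epsilon>) * (\<bar>C1\<bar> + T * \<bar>C0\<bar>)"

lemma sup_bound_nonneg: "0 \<le> T \<Longrightarrow> 0 \<le> sup_bound Ky \<epsilon> C0 C1 T"
  by (simp add: sup_bound_def)

lemma sup_bound_mono:
  assumes "0 \<le> S" "S \<le> T" "0 \<le> Ky" "0 < \<epsilon>"
  shows "sup_bound Ky \<epsilon> C0 C1 S \<le> sup_bound Ky \<epsilon> C0 C1 T"
  unfolding sup_bound_def using assms
  by (intro mult_mono add_left_mono mult_right_mono) (auto intro!: divide_right_mono mult_right_mono)

text \<open>Induction step of the Gronwall argument: one application of
  \<open>solution_bound\<close> lengthens the remaining time from \<open>S\<close> to
  \<open>S + h\<close>.\<close>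

lemma sup_bound_step:
  assumes "0 \<le> S" "0 \<le> h" "0 \<le> Ky" "0 < \<epsilon>"
  shows "exp (h * Ky / \<epsilon>) * (sup_bound Ky \<epsilon> C0 C1 S + h * \<bar>C0\<bar>) \<le> sup_bound Ky \<epsilon> C0 C1 (S + h)"
proof -
  have "1 \<le> exp (S * Ky / \<epsilon>)" using assms by simp
  then have "h * \<bar>C0\<bar> \<le> exp (S * Ky / \<epsilon>) * (h * \<bar>C0\<bar>)"
    using mult_right_mono[of 1 "exp (S * Ky / \<epsilon>)" "h * \<bar>C0\<bar>"] assms by simp
  then have "exp (h * Ky / \<epsilon>) * (sup_bound Ky \<epsilon> C0 C1 S + h * \<bar>C0\<bar>) \<le>
      exp (h * Ky / \<epsilon>) * (sup_bound Ky \<epsilon> C0 C1 S + exp (S * Ky / \<epsilon>) * (h * \<bar>C0\<bar>))"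
    by (intro mult_left_mono add_left_mono) auto
  also have "\<dots> = sup_bound Ky \<epsilon> C0 C1 (S + h)"
    by (simp add: sup_bound_def algebra_simps add_divide_distrib exp_add)
  finally show ?thesis .
qed

text \<open>The data for one fixed \<open>n\<close>, over an increasing family \<open>G\<close> of
  sub-sigma-algebras. \<open>C0\<close> and \<open>C1\<close> bound the driver at the origin and the
  terminal value, \<open>s\<close> and \<open>Lt\<close> are the growth variables and their
  conditional bound, and \<open>K\<close> is the Lipschitz constant in \<open>z\<close>.\<close>

locale bsde_scheme = prob_space M
  for M :: "'a measure" +
  fixes G :: "real \<Rightarrow> 'a measure"
    and T c1 c2 \<theta> lam Lam Ky \<epsilon> C0 C1 L Lt K :: real
    and n :: nat
    and t c :: "nat \<Rightarrow> real"
    and H Z :: "nat \<Rightarrow> 'a \<Rightarrow> real ^ 'd::finite"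
    and F :: "nat \<Rightarrow> 'a \<Rightarrow> real \<Rightarrow> real ^ 'd \<Rightarrow> real"
    and \<xi> :: "'a \<Rightarrow> real"
    and s Y :: "nat \<Rightarrow> 'a \<Rightarrow> real"
  assumes subalg_G: "\<And>r. r \<le> T \<Longrightarrow> subalgebra M (G r)"
    and mono_G: "\<And>q r. q \<le> r \<Longrightarrow> sets (G q) \<subseteq> sets (G r)"
    and constants: "0 < lam" "0 < Lam" "0 \<le> Ky" "0 < \<epsilon>" "0 < L" "0 \<le> Lt" "0 < K"
    and grid: "time_grid T c1 c2 \<theta> n t"
    and coefficients: "scheme_coefficients M G lam Lam n t c H"
    and \<xi>_bound: "AE \<omega> in M. \<bar>\<xi> \<omega>\<bar> \<le> C1"
    and F_meas: "\<And>i. i < n \<Longrightarrow>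
      (\<lambda>(\<omega>, y, z). F i \<omega> y z) \<in> borel_measurable (G (t i) \<Otimes>\<^sub>M borel \<Otimes>\<^sub>M borel)"
    and lipschitz: "\<And>i. i < n \<Longrightarrow> AE \<omega> in M. \<forall>y y' z z'.
      \<bar>F i \<omega> y z - F i \<omega> y' z'\<bar> \<le> Ky * \<bar>y - y'\<bar> + K * norm (z - z')"
    and mesh: "mesh n t * Ky < 1 - \<epsilon>"
    and H_bound: "AE \<omega> in M. (MAX i\<in>{..<n}. step t i * norm (H i \<omega>)) * K < 1"
    and F0_bound: "\<And>i. i < n \<Longrightarrow> AE \<omega> in M. \<bar>F i \<omega> 0 0\<bar> \<le> C0"
    and s_meas: "\<And>i. i < n \<Longrightarrow> s i \<in> borel_measurable M"
    and growth: "\<And>i. i < n \<Longrightarrow> AE \<omega> in M. \<forall>y z.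
      \<bar>F i \<omega> y z\<bar> \<le> Ky * \<bar>y\<bar> + L * (norm z)\<^sup>2 + s i \<omega>"
    and s_bound: "\<And>i. i < n \<Longrightarrow> AE \<omega> in M.
      nn_cond_exp M (G (t i)) (\<lambda>\<omega>'. ennreal (\<Sum>k=i..<n. step t k * \<bar>s k \<omega>'\<bar>)) \<omega> \<le> ennreal Lt"
    and solution: "scheme_solution M G n t H F \<xi> Y Z"
begin

section \<open>Grid points and the uniform bound for \<open>Y\<close>\<close>

lemma step_pos: "i < n \<Longrightarrow> 0 < step t i"
  using grid by (auto simp: time_grid_def step_def)

lemma t_mono:
  assumes "i \<le> j" "j \<le> n"
  shows "t i \<le> t j"
  using assms
proof (induction rule: dec_induct)
  case (step k)
  with step_pos[of k] show ?case by (simp add: step_def)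
qed simp

lemma t_bounds: "i \<le> n \<Longrightarrow> 0 \<le> t i" "i \<le> n \<Longrightarrow> t i \<le> T"
  using t_mono[of 0 i] t_mono[of i n] grid by (auto simp: time_grid_def)

lemma subalg_t: "i \<le> n \<Longrightarrow> subalgebra M (G (t i))"
  by (intro subalg_G t_bounds)

lemma finite_measure_subalgebra_t: "i \<le> n \<Longrightarrow> finite_measure_subalgebra M (G (t i))"
  by unfold_locales (rule subalg_t)

lemma Y_meas: "i \<le> n \<Longrightarrow> Y i \<in> borel_measurable M"
  using solution measurable_from_subalg[OF subalg_t] by (auto simp: scheme_solution_def)

text \<open>The bound on \<open>Y (Suc i)\<close> is a hypothesis because the step is entered twice:
  within the backward induction, with a bound depending on \<open>i\<close>, and after it with the
  uniform one.\<close>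

lemma scheme_step_if_bounded:
  assumes i: "i < n" and bound: "AE \<omega> in M. \<bar>Y (Suc i) \<omega>\<bar> \<le> m"
  shows "scheme_step M (G (t i)) (Y (Suc i)) (H i) (Z i) m (step t i) (c i) K"
proof -
  have coeff: "H i \<in> borel_measurable (G (t (Suc i)))" "lam / real CARD('d) \<le> c i"
    "AE \<omega> in M. vec_cond_exp M (G (t i)) (H i) \<omega> = 0"
    "AE \<omega> in M. mat (c i) = step t i *\<^sub>R mat_cond_exp M (G (t i)) (\<lambda>\<omega>'. outer (H i \<omega>')) \<omega>"
    using coefficients i by (auto simp: scheme_coefficients_def)
  have sol: "Z i \<in> borel_measurable (G (t i))"
    "AE \<omega> in M. Z i \<omega> = vec_cond_exp M (G (t i)) (\<lambda>\<omega>'. Y (Suc i) \<omega>' *\<^sub>R H i \<omega>') \<omega>"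
    using solution i by (auto simp: scheme_solution_def)
  interpret S: finite_measure_subalgebra M "G (t i)"
    using i by (intro finite_measure_subalgebra_t) simp
  have "0 < lam / real CARD('d)" using constants by simp
  then have "0 < c i" using coeff(2) by linarith
  moreover have "AE \<omega> in M. step t i * norm (H i \<omega>) * K \<le> 1"
    using H_bound
  proof eventually_elim
    case (elim \<omega>)
    have "step t i * norm (H i \<omega>) \<le> (MAX i\<in>{..<n}. step t i * norm (H i \<omega>))"
      using i by (intro Max_ge) auto
    from mult_right_mono[OF this, of K] elim constants show ?case by linarith
  qed
  moreover have "H i \<in> borel_measurable M"
    using coeff(1) i measurable_from_subalg[OF subalg_t[of "Suc i"]] by auto
  ultimately show ?thesis
    using step_pos[OF i] constants Y_meas[of "Suc i"] i bound coeff sol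
    by unfold_locales auto
qed

lemma Y_eq_if_bounded:
  assumes i: "i < n" and bound: "AE \<omega> in M. \<bar>Y (Suc i) \<omega>\<bar> \<le> m"
  shows "AE \<omega> in M. Y i \<omega> =
    scheme_step.P M (G (t i)) (Y (Suc i)) \<omega> + step t i * F i \<omega> (Y i \<omega>) (Z i \<omega>)"
proof -
  interpret S: scheme_step M "G (t i)" "Y (Suc i)" "H i" "Z i" m "step t i" "c i" K
    by (rule scheme_step_if_bounded[OF assms])
  have sol: "Y i \<in> borel_measurable (G (t i))" "Z i \<in> borel_measurable (G (t i))"
    "integrable M (\<lambda>\<omega>. Y (Suc i) \<omega> + step t i * F i \<omega> (Y i \<omega>) (Z i \<omega>))"
    "AE \<omega> in M. Y i \<omega> =
      real_cond_exp M (G (t i)) (\<lambda>\<omega>'. Y (Suc i) \<omega>' + step t i * F i \<omega>' (Y i \<omega>') (Z i \<omega>')) \<omega>"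
    using solution i by (auto simp: scheme_solution_def)
  note [measurable] = sol(1,2)
  have "(\<lambda>\<omega>. (\<omega>, Y i \<omega>, Z i \<omega>)) \<in> G (t i) \<rightarrow>\<^sub>M G (t i) \<Otimes>\<^sub>M borel \<Otimes>\<^sub>M borel"
    by measurable
  from measurable_compose[OF this F_meas[OF i]]
  have "(\<lambda>\<omega>. F i \<omega> (Y i \<omega>) (Z i \<omega>)) \<in> borel_measurable (G (t i))" by simp
  from S.solution_eq[OF this sol(3,4)] show ?thesis .
qed

text \<open>Backward induction from the terminal value. Measuring the bound by the remaining time
  lets the factors of the single steps multiply to one exponential.\<close>

lemma Y_bound_remaining_time:
  assumes "i \<le> n"
  shows "AE \<omega> in M. \<bar>Y i \<omega>\<bar> \<le> sup_bound Ky \<epsilon> C0 C1 (T - t i)"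
  using assms
proof (induction rule: inc_induct)
  case base
  have "AE \<omega> in M. Y n \<omega> = \<xi> \<omega>" "t n = T"
    using solution grid by (auto simp: scheme_solution_def time_grid_def)
  with \<xi>_bound show ?case by (auto elim!: eventually_elim2 simp: sup_bound_def)
next
  case (step i)
  interpret S: scheme_step M "G (t i)" "Y (Suc i)" "H i" "Z i"
    "sup_bound Ky \<epsilon> C0 C1 (T - t (Suc i))" "step t i" "c i" K
    by (rule scheme_step_if_bounded[OF step.hyps(2) step.IH])
  have "step t i \<le> mesh n t" using step.hyps by (auto simp: mesh_def)
  then have "step t i * Ky \<le> mesh n t * Ky" using constants by (intro mult_right_mono)
  then have "step t i * Ky \<le> 1 - \<epsilon>" using mesh by linarith
  moreover have "AE \<omega> in M. \<bar>F i \<omega> 0 0\<bar> \<le> \<bar>C0\<bar>"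
    using F0_bound[OF step.hyps(2)] by eventually_elim linarith
  ultimately have "AE \<omega> in M. \<bar>Y i \<omega>\<bar> \<le> exp (step t i * Ky / \<epsilon>) *
      (sup_bound Ky \<epsilon> C0 C1 (T - t (Suc i)) + step t i * \<bar>C0\<bar>)"
    using constants step.hyps(2) Y_eq_if_bounded[OF step.hyps(2) step.IH] lipschitz
    by (intro S.solution_bound) auto
  moreover have "exp (step t i * Ky / \<epsilon>) *
      (sup_bound Ky \<epsilon> C0 C1 (T - t (Suc i)) + step t i * \<bar>C0\<bar>) \<le>
      sup_bound Ky \<epsilon> C0 C1 (T - t (Suc i) + step t i)"
    using constants step_pos[OF step.hyps(2)] t_bounds(2)[of "Suc i"] step.hyps(2)
    by (intro sup_bound_step) auto
  moreover have "T - t (Suc i) + step t i = T - t i" by (simp add: step_def)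
  ultimately show ?case by (auto elim!: eventually_mono)
qed

lemma Y_bound:
  assumes "i \<le> n"
  shows "AE \<omega> in M. \<bar>Y i \<omega>\<bar> \<le> sup_bound Ky \<epsilon> C0 C1 T"
  using Y_bound_remaining_time[OF assms]
proof eventually_elim
  case (elim \<omega>)
  moreover have "sup_bound Ky \<epsilon> C0 C1 (T - t i) \<le> sup_bound Ky \<epsilon> C0 C1 T"
    using t_bounds[OF assms] constants by (intro sup_bound_mono) auto
  ultimately show ?case by linarith
qed

section \<open>Integrability of the growth variables\<close>

lemma step_s_nonneg: "0 \<le> (\<Sum>k=i..<n. step t k * \<bar>s k \<omega>\<bar>)"
  using step_pos by (intro sum_nonneg) (auto simp: less_imp_le)

lemma s_integral_bound:
  assumes "i < n"
  shows "integrable M (\<lambda>\<omega>. \<Sum>k=i..<n. step t k * \<bar>s k \<omega>\<bar>)"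
    "A \<in> sets (G (t i)) \<Longrightarrow>
      (\<integral>\<omega>. indicator A \<omega> * (\<Sum>k=i..<n. step t k * \<bar>s k \<omega>\<bar>) \<partial>M) \<le> Lt * measure M A"
proof -
  interpret S: finite_measure_subalgebra M "G (t i)"
    using assms by (intro finite_measure_subalgebra_t) simp
  have meas: "(\<lambda>\<omega>. \<Sum>k=i..<n. step t k * \<bar>s k \<omega>\<bar>) \<in> borel_measurable M"
    using s_meas by (intro borel_measurable_sum borel_measurable_times borel_measurable_const
      borel_measurable_abs) auto
  note D = S.nn_cond_exp_le_constD[OF meas step_s_nonneg constants(6) s_bound[OF assms]]
  show "integrable M (\<lambda>\<omega>. \<Sum>k=i..<n. step t k * \<bar>s k \<omega>\<bar>)"
    "A \<in> sets (G (t i)) \<Longrightarrow>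
      (\<integral>\<omega>. indicator A \<omega> * (\<Sum>k=i..<n. step t k * \<bar>s k \<omega>\<bar>) \<partial>M) \<le> Lt * measure M A"
    by (rule D)+
qed

text \<open>\<open>step t i * |s i|\<close> is the first summand of an integrable sum of nonnegative
  terms.\<close>

lemma s_integrable:
  assumes "i < n"
  shows "integrable M (s i)"
proof -
  have "integrable M (\<lambda>\<omega>. 1 / step t i * (\<Sum>k=i..<n. step t k * \<bar>s k \<omega>\<bar>))"
    using s_integral_bound(1)[OF assms] by simp
  then show ?thesis
  proof (rule Bochner_Integration.integrable_bound)
    show "AE \<omega> in M. norm (s i \<omega>) \<le> norm (1 / step t i * (\<Sum>k=i..<n. step t k * \<bar>s k \<omega>\<bar>))"
    proof (rule AE_I2)
      fix \<omega>
      have "step t i * \<bar>s i \<omega>\<bar> \<le> (\<Sum>k=i..<n. step t k * \<bar>s k \<omega>\<bar>)"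
        using assms step_pos by (intro member_le_sum) (auto simp: less_imp_le)
      then show "norm (s i \<omega>) \<le> norm (1 / step t i * (\<Sum>k=i..<n. step t k * \<bar>s k \<omega>\<bar>))"
        using step_pos[OF assms] step_s_nonneg[where i = i and \<omega> = \<omega>] by (simp add: field_simps)
    qed
  qed (rule s_meas[OF assms])
qed

section \<open>Drift along the grid with constants uniform in \<open>n\<close>\<close>

context
  fixes \<alpha> B \<kappa> :: real
  assumes \<alpha>: "\<alpha> = 8 * L * Lam / CARD('d)"
    and B: "B = sup_bound Ky \<epsilon> C0 C1 T"
    and \<kappa>: "\<kappa> = (exp (- (3 * \<alpha> * B)))\<^sup>2 / 16 * \<alpha>\<^sup>2 * (CARD('d) / Lam) * exp (- (\<alpha> * B))"
begin

lemma \<alpha>_pos: "0 < \<alpha>"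
  using constants by (simp add: \<alpha>)

lemma \<kappa>_pos: "0 < \<kappa>"
  using constants \<alpha>_pos by (simp add: \<kappa>)

lemma B_nonneg: "0 \<le> B"
  using t_bounds[of 0] unfolding B by (intro sup_bound_nonneg) simp

lemma integrable_step:
  assumes "k < n" "A \<in> sets M"
  shows "integrable M (\<lambda>\<omega>. indicator A \<omega> * (norm (Z k \<omega>))\<^sup>2)"
    "integrable M (\<lambda>\<omega>. indicator A \<omega> * \<bar>s k \<omega>\<bar>)"
    "integrable M (\<lambda>\<omega>. (norm (Z k \<omega>))\<^sup>2)"
proof -
  interpret S: scheme_step M "G (t k)" "Y (Suc k)" "H k" "Z k" B "step t k" "c k" K
    unfolding B using assms by (intro scheme_step_if_bounded Y_bound) auto
  show "integrable M (\<lambda>\<omega>. indicator A \<omega> * (norm (Z k \<omega>))\<^sup>2)"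
    "integrable M (\<lambda>\<omega>. (norm (Z k \<omega>))\<^sup>2)"
    by (intro integrable_ess_bounded ess_bounded_intros ess_bounded_indicator assms S.ess_bounded_Z)+
  show "integrable M (\<lambda>\<omega>. indicator A \<omega> * \<bar>s k \<omega>\<bar>)"
    using integrable_mult_indicator[OF assms(2), of "\<lambda>\<omega>. \<bar>s k \<omega>\<bar>"] s_integrable[OF assms(1)] by simp
qed

text \<open>Since \<open>c k \<le> Lam / d\<close>, putting \<open>Lam / d\<close> for
  \<open>c k\<close> enlarges the required \<alpha> and lowers the coefficient of \<open>Z\<close>;
  the resulting \<alpha> and \<kappa> depend neither on \<open>k\<close> nor on the grid.\<close>

lemma drift:
  assumes k: "k < n" and A: "A \<in> sets (G (t k))"
  shows "\<kappa> * step t k * (\<integral>\<omega>. indicator A \<omega> * (norm (Z k \<omega>))\<^sup>2 \<partial>M)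
    \<le> (\<integral>\<omega>. indicator A \<omega> * exp (\<alpha> * Y (Suc k) \<omega>) \<partial>M) - (\<integral>\<omega>. indicator A \<omega> * exp (\<alpha> * Y k \<omega>) \<partial>M)
      + \<alpha> * exp (\<alpha> * B) * (step t k * Ky * B * measure M A
          + (\<integral>\<omega>. indicator A \<omega> * (step t k * \<bar>s k \<omega>\<bar>) \<partial>M))"
proof -
  have bounds: "AE \<omega> in M. \<bar>Y (Suc k) \<omega>\<bar> \<le> B" "AE \<omega> in M. \<bar>Y k \<omega>\<bar> \<le> B"
    unfolding B using k by (auto intro!: Y_bound)
  interpret S: scheme_step M "G (t k)" "Y (Suc k)" "H k" "Z k" B "step t k" "c k" K
    by (rule scheme_step_if_bounded[OF k bounds(1)])
  have c_le: "c k \<le> Lam / CARD('d)"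
    using coefficients k by (auto simp: scheme_coefficients_def)
  then have \<alpha>_ge: "8 * L * c k \<le> \<alpha>"
    using mult_left_mono[OF c_le, of "8 * L"] constants by (simp add: \<alpha>)
  have "step t k * (CARD('d) / Lam) \<le> step t k / c k"
    using c_le S.c S.h constants by (simp add: field_simps)
  then have "\<kappa> * step t k \<le> (exp (- (3 * \<alpha> * B)))\<^sup>2 / 16 * \<alpha>\<^sup>2 * (step t k / c k) * exp (- (\<alpha> * B))"
    using mult_left_mono[of "step t k * (CARD('d) / Lam)" "step t k / c k"
        "(exp (- (3 * \<alpha> * B)))\<^sup>2 / 16 * \<alpha>\<^sup>2 * exp (- (\<alpha> * B))"]
    by (simp add: \<kappa> mult_ac)
  then have "\<kappa> * step t k * (\<integral>\<omega>. indicator A \<omega> * (norm (Z k \<omega>))\<^sup>2 \<partial>M) \<le>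
    (exp (- (3 * \<alpha> * B)))\<^sup>2 / 16 * \<alpha>\<^sup>2 * (step t k / c k) * exp (- (\<alpha> * B)) *
      (\<integral>\<omega>. indicator A \<omega> * (norm (Z k \<omega>))\<^sup>2 \<partial>M)"
    by (rule mult_right_mono) (simp add: integral_nonneg_AE)
  also have "\<dots> \<le> (\<integral>\<omega>. indicator A \<omega> * exp (\<alpha> * Y (Suc k) \<omega>) \<partial>M)
      - (\<integral>\<omega>. indicator A \<omega> * exp (\<alpha> * Y k \<omega>) \<partial>M)
      + \<alpha> * exp (\<alpha> * B) * (step t k * Ky * B * measure M A
          + (\<integral>\<omega>. indicator A \<omega> * (step t k * \<bar>s k \<omega>\<bar>) \<partial>M))"
    by (rule S.solution_drift[OF Y_eq_if_bounded[OF k bounds(1)] Y_meas bounds(2) lipschitz[OF k]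
          growth[OF k] s_integrable[OF k] constants(3,5) \<alpha>_ge A]) (use k in simp)
  finally show ?thesis .
qed

text \<open>\<open>drift\<close> is summed over \<open>k\<close> on a fixed set \<open>A\<close>.
  The exponential terms telescope to the difference of a terminal term, at most
  \<open>exp (\<alpha> * B)\<close> times the measure of \<open>A\<close>, and a nonnegative initial
  one; the step lengths add up to at most \<open>T\<close>, and \<open>s_integral_bound\<close>
  controls the rest.\<close>

lemma Z_bound:
  assumes i: "i < n"
  shows "AE \<omega> in M. nn_cond_exp M (G (t i))
      (\<lambda>\<omega>'. ennreal (\<Sum>k=i..<n. step t k * (norm (Z k \<omega>'))\<^sup>2)) \<omega>
    \<le> ennreal ((exp (\<alpha> * B) + \<alpha> * exp (\<alpha> * B) * (T * Ky * B + Lt)) / \<kappa>)"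
proof -
  interpret S: finite_measure_subalgebra M "G (t i)"
    using i by (intro finite_measure_subalgebra_t) simp
  have T: "0 \<le> T" using t_bounds[of 0] by simp
  show ?thesis
  proof (rule S.nn_cond_exp_le_constI)
    show "integrable M (\<lambda>\<omega>. \<Sum>k=i..<n. step t k * (norm (Z k \<omega>))\<^sup>2)"
      by (intro Bochner_Integration.integrable_sum integrable_mult_right integrable_step(3)[of _ "{}"]) auto
    show "0 \<le> (\<Sum>k=i..<n. step t k * (norm (Z k \<omega>))\<^sup>2)" for \<omega>
      using step_pos by (intro sum_nonneg) (auto simp: less_imp_le)
    show "0 \<le> (exp (\<alpha> * B) + \<alpha> * exp (\<alpha> * B) * (T * Ky * B + Lt)) / \<kappa>"
      using \<alpha>_pos \<kappa>_pos B_nonneg constants T by simp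
    fix A assume A: "A \<in> sets (G (t i))"
    then have AM: "A \<in> sets M" using S.subalg by (auto simp: subalgebra_def)
    \<comment> \<open>A test set for time \<open>t i\<close> remains one at all later times, so the
      same \<open>A\<close> serves every step.\<close>
    have Ak: "A \<in> sets (G (t k))" if "i \<le> k" "k < n" for k
      using A mono_G[OF t_mono[of i k]] that by auto
    define e where "e k = (\<integral>\<omega>. indicator A \<omega> * exp (\<alpha> * Y k \<omega>) \<partial>M)" for k
    have e_i: "0 \<le> e i" by (simp add: e_def integral_nonneg_AE)
    have "e n \<le> (\<integral>\<omega>. exp (\<alpha> * B) * indicator A \<omega> \<partial>M)"
      unfolding e_def
    proof (rule integral_mono_AE)
      have "ess_bounded M (Y n)"
        using Y_bound[of n] Y_meas[of n] by (auto intro!: ess_boundedI)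
      then show "integrable M (\<lambda>\<omega>. indicator A \<omega> * exp (\<alpha> * Y n \<omega>))"
        by (intro integrable_ess_bounded ess_bounded_intros ess_bounded_indicator AM)
      show "integrable M (\<lambda>\<omega>. exp (\<alpha> * B) * indicator A \<omega>)"
        by (intro integrable_ess_bounded ess_bounded_intros ess_bounded_indicator AM)
      show "AE \<omega> in M. indicator A \<omega> * exp (\<alpha> * Y n \<omega>) \<le> exp (\<alpha> * B) * indicator A \<omega>"
        using Y_bound[OF order_refl]
        by eventually_elim (use \<alpha>_pos in \<open>auto simp: B indicator_def\<close>)
    qed
    also have "\<dots> = exp (\<alpha> * B) * measure M A" using AM by simp
    finally have e_n: "e n \<le> exp (\<alpha> * B) * measure M A" .
    have "\<kappa> * (\<integral>\<omega>. indicator A \<omega> * (\<Sum>k=i..<n. step t k * (norm (Z k \<omega>))\<^sup>2) \<partial>M)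
      = (\<Sum>k=i..<n. \<kappa> * step t k * (\<integral>\<omega>. indicator A \<omega> * (norm (Z k \<omega>))\<^sup>2 \<partial>M))"
    proof -
      have "(\<integral>\<omega>. indicator A \<omega> * (\<Sum>k=i..<n. step t k * (norm (Z k \<omega>))\<^sup>2) \<partial>M)
        = (\<integral>\<omega>. (\<Sum>k=i..<n. step t k * (indicator A \<omega> * (norm (Z k \<omega>))\<^sup>2)) \<partial>M)"
        by (simp add: sum_distrib_left mult_ac)
      also have "\<dots> = (\<Sum>k=i..<n. \<integral>\<omega>. step t k * (indicator A \<omega> * (norm (Z k \<omega>))\<^sup>2) \<partial>M)"
        by (intro Bochner_Integration.integral_sum integrable_mult_right integrable_step AM) auto
      finally show ?thesis by (simp add: sum_distrib_left mult_ac)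
    qed
    also have "\<dots> \<le> (\<Sum>k=i..<n. (e (Suc k) - e k)
        + \<alpha> * exp (\<alpha> * B) * ((t (Suc k) - t k) * (Ky * B * measure M A)
          + (\<integral>\<omega>. indicator A \<omega> * (step t k * \<bar>s k \<omega>\<bar>) \<partial>M)))"
      using drift Ak unfolding e_def by (intro sum_mono) (auto simp: step_def mult_ac)
    also have "\<dots> = (e n - e i) + \<alpha> * exp (\<alpha> * B) * ((t n - t i) * (Ky * B * measure M A)
        + (\<Sum>k=i..<n. \<integral>\<omega>. indicator A \<omega> * (step t k * \<bar>s k \<omega>\<bar>) \<partial>M))"
      using i by (simp only: sum.distrib sum_Suc_diff' less_imp_le flip: sum_distrib_left sum_distrib_right)
    also have "(\<Sum>k=i..<n. \<integral>\<omega>. indicator A \<omega> * (step t k * \<bar>s k \<omega>\<bar>) \<partial>M)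
      = (\<integral>\<omega>. indicator A \<omega> * (\<Sum>k=i..<n. step t k * \<bar>s k \<omega>\<bar>) \<partial>M)"
    proof -
      have int: "integrable M (\<lambda>\<omega>. indicator A \<omega> * (step t k * \<bar>s k \<omega>\<bar>))" if "k \<in> {i..<n}" for k
        using integrable_mult_right[OF integrable_step(2)[of k A], of "step t k"] AM that
        by (simp add: mult_ac)
      show ?thesis
        unfolding sum_distrib_left by (rule Bochner_Integration.integral_sum[symmetric, OF int])
    qed
    also have "(e n - e i) + \<alpha> * exp (\<alpha> * B) * ((t n - t i) * (Ky * B * measure M A)
        + (\<integral>\<omega>. indicator A \<omega> * (\<Sum>k=i..<n. step t k * \<bar>s k \<omega>\<bar>) \<partial>M))
      \<le> exp (\<alpha> * B) * measure M A
        + \<alpha> * exp (\<alpha> * B) * (T * (Ky * B * measure M A) + Lt * measure M A)"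
      using e_n e_i t_bounds[of n] t_bounds[of i] i \<alpha>_pos constants B_nonneg
        s_integral_bound(2)[OF i A]
      by (intro add_mono mult_left_mono mult_right_mono) auto
    also have "\<dots> = (exp (\<alpha> * B) + \<alpha> * exp (\<alpha> * B) * (T * Ky * B + Lt)) * measure M A"
      by (simp add: algebra_simps)
    finally show "(\<integral>\<omega>. indicator A \<omega> * (\<Sum>k=i..<n. step t k * (norm (Z k \<omega>))\<^sup>2) \<partial>M)
      \<le> (exp (\<alpha> * B) + \<alpha> * exp (\<alpha> * B) * (T * Ky * B + Lt)) / \<kappa> * measure M A"
      using \<kappa>_pos by (simp add: field_simps)
  qed
qed

end

end

section \<open>One constant for all grids\<close>

theorem proposition2p7:
  fixes M :: "'a measure"
    and W :: "real \<Rightarrow> 'a \<Rightarrow> real ^ 'd::finite"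
    and G :: "real \<Rightarrow> 'a measure"
    and T c1 c2 \<theta> lam Lam Ky \<epsilon> Ctilde Ltilde Lamtilde Cxi :: real
    and N :: "nat set"
    and t :: "nat \<Rightarrow> nat \<Rightarrow> real"
    and c :: "nat \<Rightarrow> nat \<Rightarrow> real"
    and H :: "nat \<Rightarrow> nat \<Rightarrow> 'a \<Rightarrow> real ^ 'd"
    and F :: "nat \<Rightarrow> nat \<Rightarrow> 'a \<Rightarrow> real \<Rightarrow> real ^ 'd \<Rightarrow> real"
    and \<xi> :: "nat \<Rightarrow> 'a \<Rightarrow> real"
    and Kz :: "nat \<Rightarrow> real"
    and vs :: "nat \<Rightarrow> nat \<Rightarrow> 'a \<Rightarrow> real"
    and Y :: "nat \<Rightarrow> nat \<Rightarrow> 'a \<Rightarrow> real"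
    and Z :: "nat \<Rightarrow> nat \<Rightarrow> 'a \<Rightarrow> real ^ 'd"
  assumes BM: "brownian_motion M T W"
    and G_def: "G = brownian_filtration M W"
    and constants: "0 < T" "0 < c1" "0 < c2" "1 \<le> \<theta>" "0 < lam" "0 < Lam"
      "0 < Ky" "0 < \<epsilon>" "\<epsilon> < 1" "0 < Ltilde" "0 < Lamtilde"
    and N: "\<And>n. n \<in> N \<Longrightarrow> 1 \<le> n"
    and grid: "\<And>n. n \<in> N \<Longrightarrow> time_grid T c1 c2 \<theta> n (t n)"
    and coefficients: "\<And>n. n \<in> N \<Longrightarrow> scheme_coefficients M G lam Lam n (t n) (c n) (H n)"
    and a_measurable: "\<And>n. n \<in> N \<Longrightarrow> \<xi> n \<in> borel_measurable (G T)"
    and a_bounded: "\<And>n. n \<in> N \<Longrightarrow> AE \<omega> in M. \<bar>\<xi> n \<omega>\<bar> \<le> Cxi"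
    and b_measurable: "\<And>n i. n \<in> N \<Longrightarrow> i < n \<Longrightarrow>
      (\<lambda>(\<omega>, y, z). F n i \<omega> y z) \<in> borel_measurable (G (t n i) \<Otimes>\<^sub>M borel \<Otimes>\<^sub>M borel)"
    and b_L2: "\<And>n i. n \<in> N \<Longrightarrow> i < n \<Longrightarrow> integrable M (\<lambda>\<omega>. (F n i \<omega> 0 0)\<^sup>2)"
    and b_Kz_pos: "\<And>n. n \<in> N \<Longrightarrow> 0 < Kz n"
    and b_Lipschitz: "\<And>n i. n \<in> N \<Longrightarrow> i < n \<Longrightarrow> AE \<omega> in M. \<forall>y y' z z'.
      \<bar>F n i \<omega> y z - F n i \<omega> y' z'\<bar> \<le> Ky * \<bar>y - y'\<bar> + Kz n * norm (z - z')"
    and b_mesh: "\<And>n. n \<in> N \<Longrightarrow> mesh n (t n) * Ky < 1 - \<epsilon>"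
    and b_H: "\<And>n. n \<in> N \<Longrightarrow>
      AE \<omega> in M. (MAX i\<in>{..<n}. step (t n) i * norm (H n i \<omega>)) * Kz n < 1"
    and c_bounded: "\<And>n i. n \<in> N \<Longrightarrow> i < n \<Longrightarrow> AE \<omega> in M. \<bar>F n i \<omega> 0 0\<bar> \<le> Ctilde"
    and d_measurable: "\<And>n i. n \<in> N \<Longrightarrow> i < n \<Longrightarrow> vs n i \<in> borel_measurable M"
    and d_growth: "\<And>n i. n \<in> N \<Longrightarrow> i < n \<Longrightarrow> AE \<omega> in M. \<forall>y z.
      \<bar>F n i \<omega> y z\<bar> \<le> Ky * \<bar>y\<bar> + Ltilde * (norm z)\<^sup>2 + vs n i \<omega>"
    and d_bounded: "\<And>n i. n \<in> N \<Longrightarrow> i < n \<Longrightarrow> AE \<omega> in M.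
      nn_cond_exp M (G (t n i)) (\<lambda>\<omega>'. ennreal (\<Sum>k=i..<n. step (t n) k * \<bar>vs n k \<omega>'\<bar>)) \<omega>
        \<le> ennreal Lamtilde"
    and solution: "\<And>n. n \<in> N \<Longrightarrow> scheme_solution M G n (t n) (H n) (F n) (\<xi> n) (Y n) (Z n)"
  shows "\<exists>C::real. \<forall>n\<in>N. \<forall>i<n. AE \<omega> in M.
      nn_cond_exp M (G (t n i)) (\<lambda>\<omega>'. ennreal (\<Sum>k=i..<n. step (t n) k * (norm (Z n k \<omega>'))\<^sup>2)) \<omega>
        \<le> ennreal C"
proof -
  \<comment> \<open>The constants are fixed before \<open>n\<close> is chosen: they contain neither
    \<open>Kz n\<close> nor any quantity of the grid.\<close>
  define \<alpha> where "\<alpha> = 8 * Ltilde * Lam / CARD('d)"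
  define B where "B = sup_bound Ky \<epsilon> Ctilde Cxi T"
  define \<kappa> where "\<kappa> = (exp (- (3 * \<alpha> * B)))\<^sup>2 / 16 * \<alpha>\<^sup>2 * (CARD('d) / Lam) * exp (- (\<alpha> * B))"
  have "AE \<omega> in M.
      nn_cond_exp M (G (t n i)) (\<lambda>\<omega>'. ennreal (\<Sum>k=i..<n. step (t n) k * (norm (Z n k \<omega>'))\<^sup>2)) \<omega>
        \<le> ennreal ((exp (\<alpha> * B) + \<alpha> * exp (\<alpha> * B) * (T * Ky * B + Lamtilde)) / \<kappa>)"
    if n: "n \<in> N" and i: "i < n" for n i
  proof -
    interpret prob_space M using BM by (simp add: brownian_motion_def)
    interpret bsde_scheme M G T c1 c2 \<theta> lam Lam Ky \<epsilon> Ctilde Cxi Ltilde Lamtilde "Kz n" n "t n" "c n"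
      "H n" "Z n" "F n" "\<xi> n" "vs n" "Y n"
    proof unfold_locales
      show "subalgebra M (G r)" if "r \<le> T" for r
        unfolding G_def using BM that by (rule subalgebra_brownian_filtration)
      show "sets (G q) \<subseteq> sets (G r)" if "q \<le> r" for q r
        unfolding G_def using that by (rule brownian_filtration_mono)
    qed (use constants n in \<open>simp_all add: grid coefficients a_bounded b_measurable b_Kz_pos
      b_Lipschitz b_mesh b_H c_bounded d_measurable d_growth d_bounded solution\<close>)
    show ?thesis by (rule Z_bound[OF \<alpha>_def B_def \<kappa>_def i])
  qed
  then show ?thesis by blast
qed

end
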